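(* Let $d\ge 2$ be an even integer and $r\ge 1$ an integer. The moduli space $\mathrm{M}_d^r$ has at most $r\cdot\gcd(r,d)$ many connected components.
   Context: $\Lambda=E_8(-1)^{\oplus 2}\oplus U^{\oplus 3}$ is the K3 lattice, $\ell_d\in\Lambda$ a primitive element with $(\ell_d)^2=d$, $\Lambda_d=\ell_d^\perp$, $\Lambda_{d,r}^\vee:=(\tfrac1r\Lambda_d^\vee)/\Lambda_d^\vee\cong\operatorname{Hom}(\Lambda_d,\mathbb{Z}/r\mathbb{Z})$, and $\widetilde{\mathrm{O}}(\Lambda_d)=\ker(\mathrm{O}(\Lambda_d)\to\mathrm{O}(\Lambda_d^\vee/\Lambda_d))$, which acts naturally on $\Lambda_{d,r}^\vee$. $\mathrm{M}_d^{\mathrm{mar}}$ is the analytic fine moduli space of marked polarized K3 surfaces $(S,L,\varphi)$ of degree $d$ ($L$ primitive ample with $(L)^2=d$, $\varphi\colon L^\perp\cong\Lambda_d$ a marking); via periods it is the open submanifold of $\mathcal{D}(\Lambda_d)=\{[x]\in\mathbb{P}(\Lambda_d\otimes\mathbb{C}) : (x,x)=0,\ (x,\bar x)>0\}$ obtained by removing all hyperplanes $\delta^\perp$ with $\delta\in\Lambda_d$, $(\delta)^2=-2$. $\mathrm{M}_d^r$ is the quotient by the diagonal action of $\widetilde{\mathrm{O}}(\Lambda_d)$ of the union of the $\mathrm{M}_d^{\mathrm{mar}}\times\{v\}$ over all $v\in\Lambda_{d,r}^\vee$ of order $r$. (It is the coarse moduli space of triples $(S,L,\alpha)$ with $(S,L)$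 a polarized K3 surface of degree $d$ and $\alpha\in\operatorname{Hom}(L^\perp,\mathbb{Z}/r\mathbb{Z})$ of order $r$.) *)

theory Defs
  imports
    "HOL-Analysis.Analysis"
    "HOL-Algebra.Multiplicative_Group"
    "HOL-Library.Numeral_Type"
begin

section \<open>Quotient topologies\<close>

definition quotient_topology :: "'a topology \<Rightarrow> ('a \<Rightarrow> 'b) \<Rightarrow> 'b topology" where
  "quotient_topology X q =
     topology (\<lambda>U. U \<subseteq> q ` topspace X \<and> openin X {x \<in> topspace X. q x \<in> U})"

lemma openin_quotient_topology:
  "openin (quotient_topology X q) U \<longleftrightarrow>
     U \<subseteq> q ` topspace X \<and> openin X {x \<in> topspace X. q x \<in> U}"
proof -
  have "istopology (\<lambda>U. U \<subseteq> q ` topspace X \<and> openin X {x \<in> topspace X. q x \<in> U})"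
    unfolding istopology_def
  proof (intro conjI allI impI)
    fix S T
    assume "S \<subseteq> q ` topspace X \<and> openin X {x \<in> topspace X. q x \<in> S}"
      and "T \<subseteq> q ` topspace X \<and> openin X {x \<in> topspace X. q x \<in> T}"
    moreover have "{x \<in> topspace X. q x \<in> S \<inter> T} =
        {x \<in> topspace X. q x \<in> S} \<inter> {x \<in> topspace X. q x \<in> T}"
      by auto
    ultimately show "S \<inter> T \<subseteq> q ` topspace X"
      and "openin X {x \<in> topspace X. q x \<in> S \<inter> T}"
      by (auto simp del: Int_iff)
  next
    fix K
    assume K: "\<forall>S\<in>K. S \<subseteq> q ` topspace X \<and> openin X {x \<in> topspace X. q x \<in> S}"
    then show "\<Union>K \<subseteq> q ` topspace X" by blast
    have "{x \<in> topspace X. q x \<in> \<Union>K} = (\<Union>S\<in>K. {x \<in> topspace X. q x \<in> S})" by auto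
    then show "openin X {x \<in> topspace X. q x \<in> \<Union>K}" using K by auto
  qed
  then show ?thesis by (simp add: quotient_topology_def)
qed

lemma topspace_quotient_topology [simp]:
  "topspace (quotient_topology X q) = q ` topspace X"
proof
  show "topspace (quotient_topology X q) \<subseteq> q ` topspace X"
    using openin_quotient_topology[of X q "topspace (quotient_topology X q)"] by simp
  have "{x \<in> topspace X. q x \<in> q ` topspace X} = topspace X" by auto
  then have "openin (quotient_topology X q) (q ` topspace X)"
    by (simp add: openin_quotient_topology)
  then show "q ` topspace X \<subseteq> topspace (quotient_topology X q)"
    by (rule openin_subset)
qed

lemma quotient_map_quotient_topology: "quotient_map X (quotient_topology X q) q"
  by (auto simp: quotient_map_def openin_quotient_topology)


section \<open>The K3 lattice\<close>

text \<open>
  The index type \<open>2 \<times> 8 + 3 \<times> 2\<close> records the decomposition of the K3 lattice: two copies of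
  \<open>E\<^sub>8(-1)\<close> and three copies of \<open>U\<close>. Lattices are realised as subsets of the complexification
  \<open>\<Lambda> \<otimes> \<complex>\<close>, so that all scalar extensions are available in one ambient space.
\<close>

type_synonym k3_index = "2 \<times> 8 + 3 \<times> 2"
type_synonym k3_space = "complex ^ k3_index"

text \<open>
  Dynkin diagram \<open>T\<^sub>2\<^sub>,\<^sub>3\<^sub>,\<^sub>5\<close>: a chain \<open>0 - 1 - 2 - 3 - 4 - 5 - 6\<close> with the node \<open>7\<close> attached
  to \<open>2\<close>.
\<close>

definition E8_edges :: "(8 \<times> 8) set" where
  "E8_edges = {(0, 1), (1, 2), (2, 3), (3, 4), (4, 5), (5, 6), (2, 7)}"

definition E8_gram :: "8 \<Rightarrow> 8 \<Rightarrow> int" where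
  "E8_gram a b =
     (if a = b then 2 else if (a, b) \<in> E8_edges \<or> (b, a) \<in> E8_edges then -1 else 0)"

definition U_gram :: "2 \<Rightarrow> 2 \<Rightarrow> int" where
  "U_gram a b = (if a = b then 0 else 1)"

fun k3_gram :: "k3_index \<Rightarrow> k3_index \<Rightarrow> int" where
  "k3_gram (Inl (i, a)) (Inl (j, b)) = (if i = j then - E8_gram a b else 0)"
| "k3_gram (Inr (i, a)) (Inr (j, b)) = (if i = j then U_gram a b else 0)"
| "k3_gram (Inl _) (Inr _) = 0"
| "k3_gram (Inr _) (Inl _) = 0"

definition k3_lattice :: "k3_space set" where
  "k3_lattice = {x. \<forall>i. x $ i \<in> \<int>}"

text \<open>The \<open>\<complex>\<close>-bilinear (not Hermitian) extension of the intersection form.\<close>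

definition k3_form :: "k3_space \<Rightarrow> k3_space \<Rightarrow> complex" where
  "k3_form x y = (\<Sum>i\<in>UNIV. \<Sum>j\<in>UNIV. of_int (k3_gram i j) * x $ i * y $ j)"

definition conj_vec :: "k3_space \<Rightarrow> k3_space" where
  "conj_vec x = (\<chi> i. cnj (x $ i))"

definition primitive_in :: "k3_space set \<Rightarrow> k3_space \<Rightarrow> bool" where
  "primitive_in L x \<longleftrightarrow>
     x \<in> L \<and> (\<forall>(n::int). \<forall>y\<in>L. x = of_int n *s y \<longrightarrow> n = 1 \<or> n = -1)"

definition polarized_lattice :: "k3_space \<Rightarrow> k3_space set" where
  "polarized_lattice l = {x \<in> k3_lattice. k3_form x l = 0}"


section \<open>Dual lattices, discriminant groups and isometries\<close>

definition rational_span :: "k3_space set \<Rightarrow> k3_space set" where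
  "rational_span L = {x. \<exists>n::nat. n > 0 \<and> of_nat n *s x \<in> L}"

definition dual_lattice :: "k3_space set \<Rightarrow> k3_space set" where
  "dual_lattice L = {x \<in> rational_span L. \<forall>y\<in>L. k3_form x y \<in> \<int>}"

definition additive_group :: "k3_space set \<Rightarrow> k3_space monoid" where
  "additive_group A = \<lparr>carrier = A, mult = (+), one = 0\<rparr>"

definition discriminant_group :: "k3_space set \<Rightarrow> k3_space set monoid" where
  "discriminant_group L = additive_group (dual_lattice L) Mod L"

text \<open>\<open>(1/r L\<^sup>\<or>) / L\<^sup>\<or>\<close>; its elements are cosets \<open>v + L\<^sup>\<or>\<close>, on which isometries act by image.\<close>

definition torsion_dual :: "k3_space set \<Rightarrow> nat \<Rightarrow> k3_space set monoid" where
  "torsion_dual L r =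
     additive_group ((\<lambda>x. (1 / of_nat r) *s x) ` dual_lattice L) Mod dual_lattice L"

text \<open>
  \<open>O(L)\<close> for a nondegenerate lattice \<open>L\<close>. An isometry of \<open>L\<close> is represented by its \<open>\<complex>\<close>-linear
  extension to \<open>L \<otimes> \<complex>\<close>, further extended by the identity on the orthogonal complement of \<open>L\<close>;
  since the ambient space is the direct sum of the two, restriction to \<open>L\<close> identifies this set
  with the isometry group of \<open>L\<close>. No compatibility with the K3 lattice is required.
\<close>

definition lattice_isometries :: "k3_space set \<Rightarrow> (k3_space \<Rightarrow> k3_space) set" where
  "lattice_isometries L =
     {g. Vector_Spaces.linear (*s) (*s) g \<and> bij_betw g L L \<and>
         (\<forall>x\<in>L. \<forall>y\<in>L. k3_form (g x) (g y) = k3_form x y) \<and>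
         (\<forall>x. (\<forall>y\<in>L. k3_form x y = 0) \<longrightarrow> g x = x)}"

definition stable_isometries :: "k3_space set \<Rightarrow> (k3_space \<Rightarrow> k3_space) set" where
  "stable_isometries L =
     {g \<in> lattice_isometries L. \<forall>c\<in>carrier (discriminant_group L). g ` c = c}"


section \<open>Period domains and moduli spaces\<close>

text \<open>Points of \<open>\<P>(V)\<close> are the complex lines in \<open>V\<close>, as sets of vectors.\<close>

definition line :: "k3_space \<Rightarrow> k3_space set" where
  "line x = vec.span {x}"

definition projective_space :: "k3_space set \<Rightarrow> k3_space set topology" where
  "projective_space V = quotient_topology (top_of_set (V - {0})) line"

text \<open>\<open>k3_form x (conj_vec x)\<close> is always real, since the Gram matrix is real and symmetric.\<close>

definition period_domain :: "k3_space set \<Rightarrow> k3_space set set" where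
  "period_domain L =
     {line x | x. x \<in> vec.span L \<and> x \<noteq> 0 \<and> k3_form x x = 0 \<and> Re (k3_form x (conj_vec x)) > 0}"

definition marked_periods :: "k3_space set \<Rightarrow> k3_space set set" where
  "marked_periods L =
     {p \<in> period_domain L. \<forall>\<delta>\<in>L. k3_form \<delta> \<delta> = -2 \<longrightarrow> \<not> (\<forall>x\<in>p. k3_form x \<delta> = 0)}"

text \<open>
  The moduli space of marked polarized K3 surfaces, described through the period map as the
  complement of the hyperplanes orthogonal to the \<open>(-2)\<close>-vectors in the period domain.
\<close>

definition marked_moduli :: "k3_space \<Rightarrow> k3_space set topology" where
  "marked_moduli l =
     (let L = polarized_lattice l
      in subtopology (projective_space (vec.span L)) (marked_periods L))"

definition order_elements :: "k3_space \<Rightarrow> nat \<Rightarrow> k3_space set set" where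
  "order_elements l r =
     (let T = torsion_dual (polarized_lattice l) r in {v \<in> carrier T. group.ord T v = r})"

definition stable_orbit ::
    "k3_space \<Rightarrow> k3_space set \<times> k3_space set \<Rightarrow> (k3_space set \<times> k3_space set) set" where
  "stable_orbit l = (\<lambda>(p, v). {(g ` p, g ` v) | g. g \<in> stable_isometries (polarized_lattice l)})"

definition torsion_moduli ::
    "k3_space \<Rightarrow> nat \<Rightarrow> (k3_space set \<times> k3_space set) set topology" where
  "torsion_moduli l r =
     quotient_topology
       (prod_topology (marked_moduli l) (discrete_topology (order_elements l r)))
       (stable_orbit l)"

end

theory Submission
  imports Defs
begin

text \<open>
  A connected component of the moduli space is determined by a component of the marked period space
  and a torsion class \<open>v\<close>, up to stable isometries. There are two halves of the period space, so the
  bound follows from three facts: the classes of order \<open>r\<close> have at most \<open>r * gcd r d\<close> orbits, each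
  half minus the hyperplanes of \<open>(-2)\<close>-vectors is connected, and for every orbit some class in it is fixed
  by a stable isometry exchanging the two halves.

  The orbits are controlled by Eichler transvections. Lemma \<open>descent\<close> isolates their effect: where a
  coordinate along a hyperbolic plane takes its least positive value, this value divides all pairings
  with the lattice. Applied to the orbit of the polarization \<open>l\<close> in the unimodular K3 lattice, it moves
  \<open>l\<close> to \<open>m e 2 + f 2\<close> with \<open>d = 2 * m\<close> (lemma \<open>exists_polarized_frame\<close>), so that the orthogonal complement
  \<open>L\<close> of \<open>l\<close> contains two hyperbolic planes. Applied to a class of order \<open>r\<close> in \<open>(1/r) D / D\<close>, where \<open>D\<close> is
  the dual of \<open>L\<close>, it produces a representative with first coordinate \<open>1\<close>. Transvections then reduce it
  to \<open>n e 0 + f 0 + k proj (e 2)\<close>, where \<open>n\<close> matters modulo \<open>r\<close> and \<open>k\<close> modulo \<open>gcd r d\<close>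
  (lemma \<open>normal_form\<close>). All these transvections are isometries of the K3 lattice fixing \<open>l\<close>, and such
  isometries are stable (lemma \<open>G_stable\<close>).

  The normal forms are orthogonal to the second hyperbolic plane, so minus the identity on that plane fixes
  them; it exchanges the two halves (lemma \<open>upper_half_or_flip\<close>). Connectedness of a half
  (lemma \<open>upper_half_connected\<close>) uses its tube domain model, a convex set of complex vectors: a complex
  line through two of its points meets it in a convex open subset of \<open>\<complex>\<close>, from which the hyperplanes
  remove only countably many points.
\<close>

section \<open>Coordinates on the K3 lattice\<close>

lemma UNIV_8: "(UNIV :: 8 set) = {0, 1, 2, 3, 4, 5, 6, 7}"
proof (rule sym, rule card_subset_eq)
  show "card {0, 1, 2, 3, 4, 5, 6, 7 :: 8} = card (UNIV :: 8 set)" by simp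
qed simp_all

lemma sum_8: "(\<Sum>i\<in>(UNIV::8 set). f i) = f 0 + f 1 + f 2 + f 3 + f 4 + f 5 + f 6 + (f 7 :: 'a::comm_monoid_add)"
  unfolding UNIV_8 by (simp add: add.assoc)

lemma forall_8: "(\<forall>i::8. P i) \<longleftrightarrow> P 0 \<and> P 1 \<and> P 2 \<and> P 3 \<and> P 4 \<and> P 5 \<and> P 6 \<and> P 7"
  by (metis UNIV_I UNIV_8 insert_iff empty_iff)

notation k3_form ("\<langle>_, _\<rangle>")

lemma E8_gram_sym: "E8_gram a b = E8_gram b a"
  by (auto simp: E8_gram_def)

lemma k3_gram_sym: "k3_gram i j = k3_gram j i"
  by (cases "(i, j)" rule: k3_gram.cases) (auto simp: E8_gram_sym U_gram_def)

lemma form_sym: "\<langle>x, y\<rangle> = \<langle>y, x\<rangle>"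
  unfolding k3_form_def by (subst sum.swap) (simp add: k3_gram_sym mult_ac)

lemma form_add_left: "\<langle>x + x', y\<rangle> = \<langle>x, y\<rangle> + \<langle>x', y\<rangle>"
  by (simp add: k3_form_def algebra_simps sum.distrib)

lemma form_scale_left: "\<langle>c *s x, y\<rangle> = c * \<langle>x, y\<rangle>"
  by (simp add: k3_form_def sum_distrib_left mult_ac)

lemma form_add_right: "\<langle>y, x + x'\<rangle> = \<langle>y, x\<rangle> + \<langle>y, x'\<rangle>"
  by (metis form_add_left form_sym)

lemma form_scale_right: "\<langle>y, c *s x\<rangle> = c * \<langle>y, x\<rangle>"
  by (metis form_scale_left form_sym)

lemma form_zero: "\<langle>0, y\<rangle> = 0" "\<langle>y, 0\<rangle> = 0"
  by (simp_all add: k3_form_def)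

lemma form_uminus: "\<langle>- x, y\<rangle> = - \<langle>x, y\<rangle>" "\<langle>y, - x\<rangle> = - \<langle>y, x\<rangle>"
  by (simp_all add: k3_form_def sum_negf)

lemma form_diff: "\<langle>x - x', y\<rangle> = \<langle>x, y\<rangle> - \<langle>x', y\<rangle>" "\<langle>y, x - x'\<rangle> = \<langle>y, x\<rangle> - \<langle>y, x'\<rangle>"
  by (simp_all add: k3_form_def algebra_simps sum_subtractf)

lemmas form_linear = form_add_left form_add_right form_scale_left form_scale_right form_zero
  form_uminus form_diff

lemma E8_form_expand:
  fixes u v :: "8 \<Rightarrow> 'a::comm_ring_1"
  shows "(\<Sum>a\<in>UNIV. \<Sum>b\<in>UNIV. of_int (E8_gram a b) * u a * v b) =
    2 * (u 0 * v 0 + u 1 * v 1 + u 2 * v 2 + u 3 * v 3 + u 4 * v 4 + u 5 * v 5 + u 6 * v 6 + u 7 * v 7)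
    - (u 0 * v 1 + u 1 * v 0 + u 1 * v 2 + u 2 * v 1 + u 2 * v 3 + u 3 * v 2 + u 3 * v 4 + u 4 * v 3
     + u 4 * v 5 + u 5 * v 4 + u 5 * v 6 + u 6 * v 5 + u 2 * v 7 + u 7 * v 2)"
  by (simp add: sum_8 E8_gram_def E8_edges_def algebra_simps)

lemma sum_k3_index:
  "(\<Sum>i\<in>(UNIV::k3_index set). F i) =
     (\<Sum>i\<in>UNIV. \<Sum>a\<in>UNIV. F (Inl (i, a))) + (\<Sum>i\<in>UNIV. \<Sum>a\<in>UNIV. F (Inr (i, a)))"
  for F :: "k3_index \<Rightarrow> complex"
  by (simp add: UNIV_Plus_UNIV[symmetric] sum.Plus UNIV_Times_UNIV[symmetric] sum.cartesian_product
      del: UNIV_Plus_UNIV UNIV_Times_UNIV)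

lemma k3_gram_row_E8:
  "(\<Sum>j\<in>UNIV. \<Sum>b\<in>UNIV. of_int (k3_gram (Inl (i, a)) (Inl (j, b))) * c * y $ Inl (j, b)) =
     - (\<Sum>b\<in>UNIV. of_int (E8_gram a b) * c * (y :: k3_space) $ Inl (i, b))"
proof -
  have "(\<Sum>j\<in>UNIV. \<Sum>b\<in>UNIV. of_int (k3_gram (Inl (i, a)) (Inl (j, b))) * c * y $ Inl (j, b)) =
      (\<Sum>j\<in>UNIV. if i = j then - (\<Sum>b\<in>UNIV. of_int (E8_gram a b) * c * y $ Inl (j, b)) else 0)"
    by (intro sum.cong) (auto simp: sum_negf)
  then show ?thesis by (simp add: sum.delta)
qed

lemma k3_gram_row_U:
  "(\<Sum>j\<in>UNIV. \<Sum>b\<in>UNIV. of_int (k3_gram (Inr (i, a)) (Inr (j, b))) * c * y $ Inr (j, b)) =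
     (\<Sum>b\<in>UNIV. of_int (U_gram a b) * c * (y :: k3_space) $ Inr (i, b))"
proof -
  have "(\<Sum>j\<in>UNIV. \<Sum>b\<in>UNIV. of_int (k3_gram (Inr (i, a)) (Inr (j, b))) * c * y $ Inr (j, b)) =
      (\<Sum>j\<in>UNIV. if i = j then (\<Sum>b\<in>UNIV. of_int (U_gram a b) * c * y $ Inr (j, b)) else 0)"
    by (intro sum.cong) auto
  then show ?thesis by (simp add: sum.delta)
qed

lemma sum_2: "(\<Sum>i\<in>(UNIV::2 set). f i) = f 0 + (f 1 :: 'a::comm_monoid_add)"
proof -
  have "(UNIV :: 2 set) = {0, 1}"
    by (rule sym, rule card_subset_eq) simp_all
  show ?thesis unfolding \<open>UNIV = {0, 1}\<close> by simp
qed

lemma form_coordinates: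
  "\<langle>x, y\<rangle> = (\<Sum>i\<in>UNIV. x $ Inr (i, 0) * y $ Inr (i, 1) + x $ Inr (i, 1) * y $ Inr (i, 0))
     - (\<Sum>i\<in>UNIV. \<Sum>a\<in>UNIV. \<Sum>b\<in>UNIV. of_int (E8_gram a b) * x $ Inl (i, a) * y $ Inl (i, b))"
  unfolding k3_form_def sum_k3_index k3_gram_row_E8 k3_gram_row_U
  by (simp add: sum_negf sum_2[where f = "\<lambda>a. sum (_ a) UNIV"] sum_2 U_gram_def add.commute)

text \<open>
  Completing the squares from the three ends of the Dynkin diagram towards the branch node
  leaves \<open>2 - 2/3 - 1/2 - 4/5 = 1/30\<close> as the coefficient of the branch node.
\<close>

lemma E8_form_nonneg:
  fixes u :: "8 \<Rightarrow> real"
  shows "(\<Sum>a\<in>UNIV. \<Sum>b\<in>UNIV. of_int (E8_gram a b) * u a * u b) \<ge> 0"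
proof -
  have "(\<Sum>a\<in>UNIV. \<Sum>b\<in>UNIV. of_int (E8_gram a b) * u a * u b) =
      2 * (u 0 - u 1 / 2)^2 + 3/2 * (u 1 - 2/3 * u 2)^2 + 2 * (u 7 - u 2 / 2)^2
      + 2 * (u 6 - u 5 / 2)^2 + 3/2 * (u 5 - 2/3 * u 4)^2 + 4/3 * (u 4 - 3/4 * u 3)^2
      + 5/4 * (u 3 - 4/5 * u 2)^2 + 1/30 * (u 2)^2"
    unfolding E8_form_expand by (simp add: power2_eq_square field_simps)
  also have "\<dots> \<ge> 0" by (intro add_nonneg_nonneg mult_nonneg_nonneg) auto
  finally show ?thesis .
qed

section \<open>The K3 lattice is even and unimodular\<close>

lemma lattice_0: "0 \<in> k3_lattice"
  by (simp add: k3_lattice_def)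

lemma lattice_add: "x \<in> k3_lattice \<Longrightarrow> y \<in> k3_lattice \<Longrightarrow> x + y \<in> k3_lattice"
  by (simp add: k3_lattice_def)

lemma lattice_diff: "x \<in> k3_lattice \<Longrightarrow> y \<in> k3_lattice \<Longrightarrow> x - y \<in> k3_lattice"
  by (simp add: k3_lattice_def)

lemma lattice_uminus: "x \<in> k3_lattice \<Longrightarrow> - x \<in> k3_lattice"
  by (simp add: k3_lattice_def)

lemma lattice_scale: "x \<in> k3_lattice \<Longrightarrow> c \<in> \<int> \<Longrightarrow> c *s x \<in> k3_lattice"
  by (simp add: k3_lattice_def)

lemma lattice_axis: "axis i 1 \<in> k3_lattice"
  by (simp add: k3_lattice_def axis_def)

lemma lattice_form_Ints: "x \<in> k3_lattice \<Longrightarrow> y \<in> k3_lattice \<Longrightarrow> \<langle>x, y\<rangle> \<in> \<int>"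
  by (auto simp: k3_lattice_def k3_form_def intro!: Ints_sum Ints_mult)

lemma countable_k3_lattice: "countable k3_lattice"
proof -
  have "x \<in> range (\<lambda>c. \<chi> i. of_int (c $ i))" if "x \<in> k3_lattice" for x
  proof -
    from that have "\<forall>i. \<exists>n. x $ i = of_int n" by (auto simp: k3_lattice_def Ints_def)
    then obtain c where "\<forall>i. x $ i = of_int (c i)" by metis
    then have "x = (\<chi> i. of_int ((\<chi> i. c i) $ i))" by (simp add: vec_eq_iff)
    then show ?thesis by blast
  qed
  moreover have "countable (UNIV :: (int ^ k3_index) set)"
  proof -
    have "inj (\<lambda>c :: int ^ k3_index. ($) c)" by (auto simp: inj_on_def vec_eq_iff)
    moreover have "countable (UNIV :: (k3_index \<Rightarrow> int) set)" by simp
    ultimately show ?thesis by (metis countable_image_inj_on countable_subset subset_UNIV)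
  qed
  ultimately show ?thesis by (meson countable_image countable_subset subsetI)
qed

lemma lattice_form_even:
  assumes "x \<in> k3_lattice"
  shows "\<langle>x, x\<rangle> / 2 \<in> \<int>"
proof -
  let ?u = "\<lambda>i a. x $ Inl (i, a)"
  have [intro, simp]: "x $ i \<in> \<int>" for i using assms by (simp add: k3_lattice_def)
  have "\<langle>x, x\<rangle> / 2 = (\<Sum>i\<in>UNIV. x $ Inr (i, 0) * x $ Inr (i, 1))
    - (\<Sum>i\<in>UNIV. (?u i 0 * ?u i 0 + ?u i 1 * ?u i 1 + ?u i 2 * ?u i 2 + ?u i 3 * ?u i 3
        + ?u i 4 * ?u i 4 + ?u i 5 * ?u i 5 + ?u i 6 * ?u i 6 + ?u i 7 * ?u i 7)
      - (?u i 0 * ?u i 1 + ?u i 1 * ?u i 2 + ?u i 2 * ?u i 3 + ?u i 3 * ?u i 4 + ?u i 4 * ?u i 5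
        + ?u i 5 * ?u i 6 + ?u i 2 * ?u i 7))"
    unfolding form_coordinates E8_form_expand diff_divide_distrib sum_divide_distrib
    by (intro arg_cong2[where f = minus] sum.cong refl) (simp_all add: field_simps)
  also have "\<dots> \<in> \<int>" by (intro Ints_diff Ints_add Ints_sum Ints_mult) auto
  finally show ?thesis .
qed

text \<open>
  Pairing with a coordinate vector reads off a row of the Gram matrix. On a hyperbolic plane this
  exchanges the two coordinates, so integrality of all pairings is integrality of the coordinates.
\<close>

lemma form_axis: "\<langle>axis i 1, x\<rangle> = (\<Sum>j\<in>UNIV. of_int (k3_gram i j) * 1 * x $ j)"
proof -
  have "\<langle>axis i 1, x\<rangle> = (\<Sum>k\<in>UNIV. if i = k then \<Sum>j\<in>UNIV. of_int (k3_gram k j) * 1 * x $ j else 0)"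
    unfolding k3_form_def by (intro sum.cong refl) (auto simp: axis_def)
  then show ?thesis by (simp add: sum.delta)
qed

lemma form_axis_hyperbolic:
  "\<langle>axis (Inr (i, 0)) 1, x\<rangle> = x $ Inr (i, 1)"
  "\<langle>axis (Inr (i, 1)) 1, x\<rangle> = x $ Inr (i, 0)"
  unfolding form_axis sum_k3_index k3_gram_row_U by (simp_all add: sum_2 U_gram_def)

lemma form_axis_E8:
  "\<langle>axis (Inl (i, a)) 1, x\<rangle> = - (\<Sum>b\<in>UNIV. of_int (E8_gram a b) * x $ Inl (i, b))"
  unfolding form_axis sum_k3_index k3_gram_row_E8 by simp

text \<open>
  The coefficients are the entries of the inverse of the \<open>E\<^sub>8\<close> Gram matrix, which is integral because
  the determinant is \<open>1\<close>.
\<close>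

lemma E8_unimodular:
  fixes u :: "8 \<Rightarrow> complex"
  assumes "\<And>a. (\<Sum>b\<in>UNIV. of_int (E8_gram a b) * u b) \<in> \<int>"
  shows "u a \<in> \<int>"
proof -
  define p where "p a = (\<Sum>b\<in>UNIV. of_int (E8_gram a b) * u b)" for a
  have p [simp, intro]: "p a \<in> \<int>" for a using assms by (simp add: p_def)
  have ex: "p 0 = 2 * u 0 - u 1" "p 1 = 2 * u 1 - u 0 - u 2" "p 2 = 2 * u 2 - u 1 - u 3 - u 7"
    "p 3 = 2 * u 3 - u 2 - u 4" "p 4 = 2 * u 4 - u 3 - u 5" "p 5 = 2 * u 5 - u 4 - u 6"
    "p 6 = 2 * u 6 - u 5" "p 7 = 2 * u 7 - u 2"
    by (simp_all add: p_def sum_8 E8_gram_def E8_edges_def)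
  have "u 0 = 4*p 0 + 7*p 1 + 10*p 2 + 8*p 3 + 6*p 4 + 4*p 5 + 2*p 6 + 5*p 7"
    unfolding ex by (simp add: algebra_simps)
  moreover have "u 1 = 7*p 0 + 14*p 1 + 20*p 2 + 16*p 3 + 12*p 4 + 8*p 5 + 4*p 6 + 10*p 7"
    unfolding ex by (simp add: algebra_simps)
  moreover have "u 2 = 10*p 0 + 20*p 1 + 30*p 2 + 24*p 3 + 18*p 4 + 12*p 5 + 6*p 6 + 15*p 7"
    unfolding ex by (simp add: algebra_simps)
  moreover have "u 3 = 8*p 0 + 16*p 1 + 24*p 2 + 20*p 3 + 15*p 4 + 10*p 5 + 5*p 6 + 12*p 7"
    unfolding ex by (simp add: algebra_simps)
  moreover have "u 4 = 6*p 0 + 12*p 1 + 18*p 2 + 15*p 3 + 12*p 4 + 8*p 5 + 4*p 6 + 9*p 7"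
    unfolding ex by (simp add: algebra_simps)
  moreover have "u 5 = 4*p 0 + 8*p 1 + 12*p 2 + 10*p 3 + 8*p 4 + 6*p 5 + 3*p 6 + 6*p 7"
    unfolding ex by (simp add: algebra_simps)
  moreover have "u 6 = 2*p 0 + 4*p 1 + 6*p 2 + 5*p 3 + 4*p 4 + 3*p 5 + 2*p 6 + 3*p 7"
    unfolding ex by (simp add: algebra_simps)
  moreover have "u 7 = 5*p 0 + 10*p 1 + 15*p 2 + 12*p 3 + 9*p 4 + 6*p 5 + 3*p 6 + 8*p 7"
    unfolding ex by (simp add: algebra_simps)
  ultimately have "\<forall>a. u a \<in> \<int>"
    unfolding forall_8 by (auto intro!: Ints_add Ints_mult)
  then show ?thesis by blast
qed

text \<open>
  Unimodularity. It turns divisibility of all pairings of a vector into divisibility of the vector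
  itself, and integral functionals into lattice vectors.
\<close>

lemma k3_lattice_self_dual:
  assumes "\<And>y. y \<in> k3_lattice \<Longrightarrow> \<langle>y, x\<rangle> \<in> \<int>"
  shows "x \<in> k3_lattice"
proof -
  have ax: "\<langle>axis i 1, x\<rangle> \<in> \<int>" for i using assms lattice_axis by blast
  have "x $ Inl (i, a) \<in> \<int>" for i a
  proof (rule E8_unimodular[where u = "\<lambda>a. x $ Inl (i, a)"])
    fix a
    show "(\<Sum>b\<in>UNIV. of_int (E8_gram a b) * x $ Inl (i, b)) \<in> \<int>"
      using Ints_minus[OF ax[of "Inl (i, a)"]] by (simp add: form_axis_E8)
  qed
  moreover have "x $ Inr (i, a) \<in> \<int>" for i a
  proof -
    have "a = 0 \<or> a = 1" using exhaust_2[of a] by auto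
    then show ?thesis using ax[of "Inr (i, 0)"] ax[of "Inr (i, 1)"]
      by (auto simp: form_axis_hyperbolic)
  qed
  ultimately have "x $ i \<in> \<int>" for i by (cases i) auto
  then show ?thesis by (simp add: k3_lattice_def)
qed

text \<open>
  A vector orthogonal to the lattice would have all its complex multiples in the lattice, by
  self-duality; rescaling a nonzero coordinate to \<open>1/2\<close> excludes this.
\<close>

lemma k3_form_nondegenerate:
  assumes "\<And>y. y \<in> k3_lattice \<Longrightarrow> \<langle>y, x\<rangle> = 0"
  shows "x = 0"
proof (rule ccontr)
  assume "x \<noteq> 0"
  then obtain i where i: "x $ i \<noteq> 0" by (auto simp: vec_eq_iff)
  have "(1 / (2 * x $ i)) *s x \<in> k3_lattice"
    by (rule k3_lattice_self_dual) (simp add: form_linear assms)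
  then have "(1/2 :: complex) \<in> \<int>" using i by (auto simp: k3_lattice_def dest!: spec[of _ i])
  then obtain n :: int where "(1/2 :: complex) = of_int n" by (auto simp: Ints_def)
  then have "of_int (2 * n) = (of_int 1 :: complex)" by (simp add: field_simps)
  then have "2 * n = 1" by (simp only: of_int_eq_iff)
  then show False by presburger
qed

section \<open>Complex conjugation and the definite part\<close>

lemma conj_vec_simps:
  "conj_vec (x + y) = conj_vec x + conj_vec y" "conj_vec (x - y) = conj_vec x - conj_vec y"
  "conj_vec (c *s x) = cnj c *s conj_vec x" "conj_vec (conj_vec x) = x"
  by (simp_all add: conj_vec_def vec_eq_iff)

lemma form_conj: "\<langle>conj_vec x, conj_vec y\<rangle> = cnj \<langle>x, y\<rangle>"
  by (simp add: k3_form_def conj_vec_def)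

lemma conj_lattice: "x \<in> k3_lattice \<Longrightarrow> conj_vec x = x"
  by (auto simp: k3_lattice_def conj_vec_def vec_eq_iff complex_is_Int_iff complex_eq_iff)

lemma negative_on_E8_part:
  assumes "conj_vec x = x"
    and "\<And>i a. x $ Inr (i, a) = 0"
  shows "Re \<langle>x, x\<rangle> \<le> 0"
proof -
  have re: "x $ i = of_real (Re (x $ i))" for i
    using assms(1) by (auto simp: conj_vec_def vec_eq_iff complex_eq_iff)
  have term_re: "of_int n * x $ i * x $ j = of_real (of_int n * Re (x $ i) * Re (x $ j))" for n i j
    by (subst re[of i], subst re[of j]) simp
  have "\<langle>x, x\<rangle> = - of_real (\<Sum>i\<in>UNIV. \<Sum>a\<in>UNIV. \<Sum>b\<in>UNIV.
      of_int (E8_gram a b) * Re (x $ Inl (i, a)) * Re (x $ Inl (i, b)))"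
    unfolding form_coordinates term_re by (simp add: assms(2))
  then show ?thesis by (simp add: sum_nonneg E8_form_nonneg)
qed

section \<open>Isometries of the K3 lattice\<close>

definition k3_isometries :: "(k3_space \<Rightarrow> k3_space) set" where
  "k3_isometries = {g. Vector_Spaces.linear (*s) (*s) g \<and> bij g \<and> g ` k3_lattice = k3_lattice \<and>
     (\<forall>x y. \<langle>g x, g y\<rangle> = \<langle>x, y\<rangle>)}"

lemma linear_k3_iff:
  "Vector_Spaces.linear (*s) (*s) (g :: k3_space \<Rightarrow> k3_space) \<longleftrightarrow>
     (\<forall>x y. g (x + y) = g x + g y) \<and> (\<forall>c x. g (c *s x) = c *s g x)"
  unfolding Vector_Spaces.linear_iff using vec.vector_space_axioms by auto

lemma isometryD:
  assumes "g \<in> k3_isometries"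
  shows "g (x + y) = g x + g y" "g (x - y) = g x - g y" "g (c *s x) = c *s g x"
    "\<langle>g x, g y\<rangle> = \<langle>x, y\<rangle>" "x \<in> k3_lattice \<Longrightarrow> g x \<in> k3_lattice" "bij g"
proof -
  have *: "g (x + y) = g x + g y" "g (c *s x) = c *s g x" for x y c
    using assms by (auto simp: k3_isometries_def linear_k3_iff)
  show "g (x + y) = g x + g y" "g (c *s x) = c *s g x" by (fact *)+
  have "g (x - y) + g y = g x" by (simp flip: *(1))
  then show "g (x - y) = g x - g y" by (simp add: algebra_simps)
  show "\<langle>g x, g y\<rangle> = \<langle>x, y\<rangle>" "x \<in> k3_lattice \<Longrightarrow> g x \<in> k3_lattice" "bij g"
    using assms by (auto simp: k3_isometries_def)
qed

lemma isometry_id: "id \<in> k3_isometries"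
  by (simp add: k3_isometries_def linear_k3_iff)

lemma isometry_comp:
  assumes "g \<in> k3_isometries" "h \<in> k3_isometries"
  shows "g \<circ> h \<in> k3_isometries"
proof -
  have "(g \<circ> h) ` k3_lattice = k3_lattice"
    using assms unfolding k3_isometries_def image_comp[symmetric] by simp
  then show ?thesis using assms by (simp add: k3_isometries_def linear_k3_iff bij_comp)
qed

lemma isometry_inv:
  assumes "g \<in> k3_isometries"
  shows "inv_into UNIV g \<in> k3_isometries"
proof -
  note g = isometryD[OF assms]
  have s: "g (inv_into UNIV g x) = x" and i: "inv_into UNIV g (g x) = x" for x
    using g(6) by (simp_all add: bij_is_surj surj_f_inv_f bij_is_inj)
  have "inv_into UNIV g (x + y) = inv_into UNIV g x + inv_into UNIV g y" for x y
    by (metis g(1) s i)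
  moreover have "inv_into UNIV g (c *s x) = c *s inv_into UNIV g x" for c x
    by (metis g(3) s i)
  moreover have "\<langle>inv_into UNIV g x, inv_into UNIV g y\<rangle> = \<langle>x, y\<rangle>" for x y
    by (metis g(4) s)
  moreover have "inv_into UNIV g ` k3_lattice = k3_lattice"
  proof -
    have "g ` k3_lattice = k3_lattice" using assms by (simp add: k3_isometries_def)
    then show ?thesis using image_inv_f_f[OF bij_is_inj[OF g(6)], of k3_lattice] by simp
  qed
  ultimately show ?thesis
    using bij_imp_bij_inv[OF g(6)] by (simp add: k3_isometries_def linear_k3_iff)
qed

lemma isometryI:
  assumes "\<And>x y. g (x + y) = g x + g y" "\<And>c x. g (c *s x) = c *s g x"
    "\<And>x y. \<langle>g x, g y\<rangle> = \<langle>x, y\<rangle>" "\<And>x. x \<in> k3_lattice \<Longrightarrow> g x \<in> k3_lattice"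
    "\<And>x. x \<in> k3_lattice \<Longrightarrow> h x \<in> k3_lattice" "\<And>x. g (h x) = x" "\<And>x. h (g x) = x"
  shows "g \<in> k3_isometries"
proof -
  have "bij g" by (rule o_bij[of h]) (simp_all add: fun_eq_iff assms)
  moreover have "g ` k3_lattice = k3_lattice"
    using assms(4-6) by (auto simp: image_iff) metis
  ultimately show ?thesis
    by (simp add: k3_isometries_def linear_k3_iff assms)
qed

text \<open>
  An isometry sends the coordinate vectors to integral, hence real, vectors; so its matrix is real.
\<close>

lemma isometry_conj:
  assumes "g \<in> k3_isometries"
  shows "g (conj_vec x) = conj_vec (g x)"
proof -
  note g = isometryD[OF assms]
  have sum: "g (\<Sum>i\<in>I. c i *s axis i 1) = (\<Sum>i\<in>I. c i *s g (axis i 1))" if "finite I" for c and I :: "k3_index set"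
    using that
  proof (induction I)
    case empty
    show ?case using g(3)[of 0 0] by simp
  qed (simp add: g)
  have x: "x = (\<Sum>i\<in>UNIV. x $ i *s axis i 1)" for x :: k3_space
    by (simp add: basis_expansion)
  have conj_sum: "conj_vec (\<Sum>i\<in>I. c i *s v i) = (\<Sum>i\<in>I. cnj (c i) *s conj_vec (v i))" for c v and I :: "k3_index set"
    by (simp add: conj_vec_def vec_eq_iff)
  have gc: "conj_vec (g (axis i 1)) = g (axis i 1)" for i
    by (intro conj_lattice g lattice_axis)
  have "conj_vec x = (\<Sum>i\<in>UNIV. cnj (x $ i) *s axis i 1)"
    by (subst x) (simp add: conj_vec_def)
  then have "g (conj_vec x) = (\<Sum>i\<in>UNIV. cnj (x $ i) *s g (axis i 1))" by (simp add: sum)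
  also have "\<dots> = conj_vec (\<Sum>i\<in>UNIV. x $ i *s g (axis i 1))" by (simp add: conj_sum gc)
  also have "(\<Sum>i\<in>UNIV. x $ i *s g (axis i 1)) = g x"
    by (subst (2) x) (simp add: sum)
  finally show ?thesis .
qed

section \<open>Eichler transvections\<close>

text \<open>
  The Eichler transvection of an isotropic vector \<open>e\<close> and a vector \<open>a\<close> orthogonal to it. It preserves
  an even lattice because \<open>\<langle>a, a\<rangle> / 2\<close> is an integer there.
\<close>

definition transvection :: "k3_space \<Rightarrow> k3_space \<Rightarrow> k3_space \<Rightarrow> k3_space" where
  "transvection e a x = x + \<langle>e, x\<rangle> *s a - (\<langle>a, x\<rangle> + \<langle>a, a\<rangle> / 2 * \<langle>e, x\<rangle>) *s e"

lemma transvection_inverse: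
  assumes "\<langle>e, e\<rangle> = 0" "\<langle>e, a\<rangle> = 0"
  shows "transvection e (- a) (transvection e a x) = x"
proof -
  have "\<langle>a, e\<rangle> = 0" using assms by (simp add: form_sym)
  then show ?thesis using assms by (simp add: transvection_def form_linear vec_eq_iff algebra_simps)
qed

lemma transvection_isometry:
  assumes e: "\<langle>e, e\<rangle> = 0" "\<langle>e, a\<rangle> = 0" and "e \<in> k3_lattice" "a \<in> k3_lattice"
  shows "transvection e a \<in> k3_isometries"
proof -
  have lat: "transvection e b x \<in> k3_lattice" if "x \<in> k3_lattice" "b \<in> k3_lattice" for b x
    unfolding transvection_def using that assms lattice_form_even[of b]
    by (intro lattice_diff lattice_add lattice_scale Ints_add Ints_mult lattice_form_Ints) auto
  show ?thesis
  proof (rule isometryI[where h = "transvection e (- a)"])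
    show "\<langle>transvection e a x, transvection e a y\<rangle> = \<langle>x, y\<rangle>" for x y
    proof -
      have "\<langle>a, e\<rangle> = 0" "\<langle>x, e\<rangle> = \<langle>e, x\<rangle>" "\<langle>x, a\<rangle> = \<langle>a, x\<rangle>" using e by (simp_all add: form_sym)
      then show ?thesis using e by (simp add: transvection_def form_linear algebra_simps)
    qed
    show "transvection e a (transvection e (- a) x) = x" for x
      using transvection_inverse[of e "- a"] e by (simp add: form_linear)
    show "transvection e (- a) (transvection e a x) = x" for x
      using transvection_inverse e by simp
    show "transvection e a (x + y) = transvection e a x + transvection e a y" for x y
      by (simp add: transvection_def form_linear vec_eq_iff algebra_simps)
    show "transvection e a (c *s x) = c *s transvection e a x" for c x
      by (simp add: transvection_def form_linear vec_eq_iff algebra_simps)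
  qed (use assms in \<open>simp_all add: lat lattice_uminus\<close>)
qed

lemma transvection_fixes:
  "\<langle>e, x\<rangle> = 0 \<Longrightarrow> \<langle>a, x\<rangle> = 0 \<Longrightarrow> transvection e a x = x"
  by (simp add: transvection_def)

section \<open>Descent along hyperbolic planes\<close>

text \<open>
  Three orthogonal hyperbolic planes \<open>\<langle>e i, f i\<rangle>\<close> whose common orthogonal complement is negative
  semidefinite over the reals. The definite part is recorded only through this inequality, so
  that the positive directions of the form all come from the three planes.
\<close>

locale hyperbolic_frame =
  fixes e f :: "3 \<Rightarrow> k3_space"
  assumes frame_lattice [simp]: "e i \<in> k3_lattice" "f i \<in> k3_lattice"
    and frame_form [simp]: "\<langle>e i, e j\<rangle> = 0" "\<langle>f i, f j\<rangle> = 0" "\<langle>e i, f j\<rangle> = (if i = j then 1 else 0)"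
    and frame_negative: "\<lbrakk>conj_vec x = x; \<And>i. \<langle>e i, x\<rangle> = 0; \<And>i. \<langle>f i, x\<rangle> = 0\<rbrakk> \<Longrightarrow> Re \<langle>x, x\<rangle> \<le> 0"
begin

lemma frame_form' [simp]: "\<langle>f i, e j\<rangle> = (if i = j then 1 else 0)"
  by (subst form_sym) simp

text \<open>
  The arithmetic core. Let \<open>b\<close> be the least positive value of \<open>\<langle>e i, _\<rangle>\<close> on a set \<open>S\<close> that is stable under
  the transvections along \<open>e i\<close> and \<open>f i\<close>. Transvections along \<open>e i\<close> keep this value and change other pairings
  by multiples of \<open>b\<close>; transvections along \<open>f i\<close> subtract other pairings from it. If some pairing of a
  minimal vector were not divisible by \<open>b\<close>, reducing it modulo \<open>b\<close> and subtracting it would give a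
  smaller positive value. The second plane \<open>e j, f j\<close> is the room needed for these reductions.
\<close>

lemma descent:
  fixes L S :: "k3_space set"
  assumes ij [simp]: "i \<noteq> j"
    and L: "L \<subseteq> k3_lattice" "e i \<in> L" "f i \<in> L" "e j \<in> L" "f j \<in> L"
      "\<And>x y. x \<in> L \<Longrightarrow> y \<in> L \<Longrightarrow> x + y \<in> L" "\<And>x n. x \<in> L \<Longrightarrow> of_int n *s x \<in> L"
    and integral: "\<And>a x. a \<in> L \<Longrightarrow> x \<in> S \<Longrightarrow> \<langle>a, x\<rangle> \<in> \<int>"
    and closed: "\<And>a x. \<lbrakk>a \<in> L; \<langle>e i, a\<rangle> = 0; \<langle>f i, a\<rangle> = 0; x \<in> S\<rbrakk> \<Longrightarrow> transvection (e i) a x \<in> S"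
      "\<And>a x. \<lbrakk>a \<in> L; \<langle>e i, a\<rangle> = 0; \<langle>f i, a\<rangle> = 0; x \<in> S\<rbrakk> \<Longrightarrow> transvection (f i) a x \<in> S"
    and start: "x0 \<in> S" "\<langle>e i, x0\<rangle> = of_nat n0" "n0 > 0"
  obtains \<beta> :: nat where "\<beta> > 0" "\<exists>x\<in>S. \<langle>e i, x\<rangle> = of_nat \<beta>"
    "\<And>x a. \<lbrakk>x \<in> S; \<langle>e i, x\<rangle> = of_nat \<beta>; a \<in> L\<rbrakk> \<Longrightarrow> \<exists>n. \<langle>a, x\<rangle> = of_int (int \<beta> * n)"
proof -
  note ij[symmetric, simp]
  define P where "P n \<longleftrightarrow> n > 0 \<and> (\<exists>x\<in>S. \<langle>e i, x\<rangle> = of_nat n)" for n :: nat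
  define b where "b = int (LEAST n. P n)"
  have "P n0" using start by (auto simp: P_def)
  then have "P (nat b)" unfolding b_def by (simp add: LeastI)
  then have b: "b > 0" and ex: "\<exists>x\<in>S. \<langle>e i, x\<rangle> = of_int b" by (auto simp: P_def)
  have minimal: "b \<le> n" if "x \<in> S" "\<langle>e i, x\<rangle> = of_int n" "n > 0" for x n
  proof -
    have "P (nat n)" using that by (auto simp: P_def)
    then show ?thesis using Least_le[of P "nat n"] that(3) by (simp add: b_def)
  qed
  have sub: "x - y \<in> L" if "x \<in> L" "y \<in> L" for x y
    using L(6)[OF that(1) L(7)[OF that(2), of "-1"]] by (simp add: vec_eq_iff)
  have t_e: "\<langle>f i, transvection (e i) a x\<rangle> = \<langle>f i, x\<rangle> - \<langle>a, x\<rangle> - \<langle>a, a\<rangle> / 2 * \<langle>e i, x\<rangle>"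
    if "\<langle>f i, a\<rangle> = 0" for a x
    using that by (simp add: transvection_def form_linear)
  have t_orth: "\<langle>c, transvection (e i) a x\<rangle> = \<langle>c, x\<rangle> + \<langle>e i, x\<rangle> * \<langle>c, a\<rangle>"
    if "\<langle>c, e i\<rangle> = 0" for a x c
    using that by (simp add: transvection_def form_linear)
  have t_f: "\<langle>e i, transvection (f i) a x\<rangle> = \<langle>e i, x\<rangle> - \<langle>a, x\<rangle> - \<langle>a, a\<rangle> / 2 * \<langle>f i, x\<rangle>"
    if "\<langle>e i, a\<rangle> = 0" for a x
    using that by (simp add: transvection_def form_linear)
  \<comment> \<open>Reducing the pairing with \<open>u\<close> modulo \<open>b\<close> and then subtracting it from \<open>b\<close> stays positive.\<close>
  have plane: "b dvd s"
    if x: "x \<in> S" "\<langle>e i, x\<rangle> = of_int b" "\<langle>u, x\<rangle> = of_int s"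
      and u: "(u, u') = (e j, f j) \<or> (u, u') = (f j, e j)" for x u u' s
  proof -
    have uL: "u \<in> L" "u' \<in> L" and uo: "\<langle>e i, u\<rangle> = 0" "\<langle>f i, u\<rangle> = 0" "\<langle>e i, u'\<rangle> = 0" "\<langle>f i, u'\<rangle> = 0"
      "\<langle>u, u\<rangle> = 0" "\<langle>u, u'\<rangle> = 1" "\<langle>u, e i\<rangle> = 0"
      using u L by auto
    define y where "y = transvection (e i) (of_int (- (s div b)) *s u') x"
    define z where "z = transvection (f i) u y"
    have "y \<in> S" unfolding y_def using uo x(1) by (intro closed L(7) uL) (auto simp: form_linear)
    then have "z \<in> S" unfolding z_def by (intro closed uL uo)
    have "\<langle>e i, y\<rangle> = of_int b" "\<langle>u, y\<rangle> = of_int (s - b * (s div b))"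
      unfolding y_def using uo x by (simp_all add: t_orth form_linear)
    then have "\<langle>e i, z\<rangle> = of_int (b - s mod b)"
      unfolding z_def using uo by (simp add: t_f minus_mult_div_eq_mod)
    from minimal[OF \<open>z \<in> S\<close> this] b pos_mod_bound[OF b, of s] pos_mod_sign[OF b, of s]
    show ?thesis by (auto simp: dvd_eq_mod_eq_0)
  qed
  have opposite: "b dvd \<alpha>"
    if x: "x \<in> S" "\<langle>e i, x\<rangle> = of_int b" "\<langle>f i, x\<rangle> = of_int \<alpha>" for x \<alpha>
  proof -
    obtain s where s: "\<langle>e j, x\<rangle> = of_int s" using integral[OF L(4) x(1)] by (auto simp: Ints_def)
    obtain c where c: "\<langle>f j, x\<rangle> = of_int c" using integral[OF L(5) x(1)] by (auto simp: Ints_def)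
    have "b dvd s" "b dvd c" using plane[OF x(1,2) s] plane[OF x(1,2) c] by auto
    then obtain s' c' where s': "s = b * s'" and c': "c = b * c'" by (auto simp: dvd_def)
    \<comment> \<open>With these coefficients the pairing with \<open>e i\<close> below becomes \<open>b - \<alpha> mod b\<close>.\<close>
    define q where "q = \<alpha> div b"
    define z where "z = 2 - c' + s' * c' + q"
    define a where "a = of_int z *s e j + of_int (2 - s') *s f j"
    define y where "y = transvection (e i) a x"
    define w where "w = transvection (f i) (e j + f j) y"
    have "a \<in> L" unfolding a_def by (intro L)
    then have aL: "a \<in> L" "\<langle>e i, a\<rangle> = 0" "\<langle>f i, a\<rangle> = 0" by (simp_all add: a_def form_linear)
    have "y \<in> S" unfolding y_def by (intro closed aL x)
    then have "w \<in> S" unfolding w_def by (intro closed L) (simp_all add: form_linear)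
    have y: "\<langle>e i, y\<rangle> = of_int b" "\<langle>e j, y\<rangle> = of_int (s + b * (2 - s'))" "\<langle>f j, y\<rangle> = of_int (c + b * z)"
      "\<langle>f i, y\<rangle> = of_int (\<alpha> - (z * s + (2 - s') * c) - z * (2 - s') * b)"
      unfolding y_def using aL x by (simp_all add: t_e t_orth) (simp_all add: a_def form_linear s c field_simps)
    have "\<langle>e i, w\<rangle> = \<langle>e i, y\<rangle> - (\<langle>e j, y\<rangle> + \<langle>f j, y\<rangle>) - \<langle>f i, y\<rangle>"
      by (simp add: w_def t_f form_linear)
    also have "\<dots> = of_int (b - (s + b * (2 - s') + (c + b * z)) - (\<alpha> - (z * s + (2 - s') * c) - z * (2 - s') * b))"
      unfolding y of_int_diff of_int_add ..
    also have "b - (s + b * (2 - s') + (c + b * z)) - (\<alpha> - (z * s + (2 - s') * c) - z * (2 - s') * b) = b - \<alpha> mod b"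
    proof -
      have "\<alpha> mod b = \<alpha> - b * q" by (simp add: q_def minus_mult_div_eq_mod)
      then show ?thesis unfolding z_def s' c' by (simp add: algebra_simps)
    qed
    finally have "\<langle>e i, w\<rangle> = of_int (b - \<alpha> mod b)" .
    from minimal[OF \<open>w \<in> S\<close> this] b pos_mod_bound[OF b, of \<alpha>] pos_mod_sign[OF b, of \<alpha>]
    show ?thesis by (auto simp: dvd_eq_mod_eq_0)
  qed
  \<comment> \<open>The transvection along \<open>e i\<close> and \<open>a\<close> changes \<open>\<langle>f i, x\<rangle>\<close> by \<open>\<langle>a, x\<rangle>\<close>, up to a multiple of \<open>b\<close>.\<close>
  have orth: "\<exists>n. \<langle>a, x\<rangle> = of_int (b * n)"
    if x: "x \<in> S" "\<langle>e i, x\<rangle> = of_int b" and a: "a \<in> L" "\<langle>e i, a\<rangle> = 0" "\<langle>f i, a\<rangle> = 0" for x a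
  proof -
    obtain \<alpha> where \<alpha>: "\<langle>f i, x\<rangle> = of_int \<alpha>" using integral[OF L(3) x(1)] by (auto simp: Ints_def)
    obtain p where p: "\<langle>a, x\<rangle> = of_int p" using integral[OF a(1) x(1)] by (auto simp: Ints_def)
    obtain q where q: "\<langle>a, a\<rangle> / 2 = of_int q"
      using lattice_form_even[OF subsetD[OF L(1) a(1)]] by (rule Ints_cases)
    have "\<langle>f i, transvection (e i) a x\<rangle> = of_int (\<alpha> - p - q * b)"
      using a x p q \<alpha> by (simp add: t_e)
    moreover have "transvection (e i) a x \<in> S" "\<langle>e i, transvection (e i) a x\<rangle> = of_int b"
      using a x by (simp_all add: closed t_orth)
    ultimately have "b dvd \<alpha> - p - q * b" by (intro opposite)
    moreover have "b dvd \<alpha>" using opposite x \<alpha> by blast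
    ultimately have "b dvd \<alpha> - (\<alpha> - p - q * b)" by (simp only: dvd_diff)
    then have "b dvd \<alpha> - (\<alpha> - p - q * b) - q * b" by (rule dvd_diff) simp
    then have "b dvd p" by simp
    then show ?thesis using p by (auto simp: dvd_def)
  qed
  have all: "\<exists>n. \<langle>a, x\<rangle> = of_int (b * n)"
    if x: "x \<in> S" "\<langle>e i, x\<rangle> = of_int b" and a: "a \<in> L" for x a
  proof -
    have "a \<in> k3_lattice" using a L(1) by blast
    then obtain p q where pq: "\<langle>e i, a\<rangle> = of_int p" "\<langle>f i, a\<rangle> = of_int q"
      by (meson Ints_cases frame_lattice lattice_form_Ints)
    define a' where "a' = a - (of_int q *s e i + of_int p *s f i)"
    have "a' \<in> L" unfolding a'_def by (intro sub L a)
    moreover have "\<langle>e i, a'\<rangle> = 0" "\<langle>f i, a'\<rangle> = 0" by (simp_all add: a'_def form_linear pq)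
    ultimately obtain n where n: "\<langle>a', x\<rangle> = of_int (b * n)" using orth[OF x] by blast
    obtain \<alpha> where \<alpha>: "\<langle>f i, x\<rangle> = of_int \<alpha>" using integral[OF L(3) x(1)] by (auto simp: Ints_def)
    then have "b dvd \<alpha>" using opposite x by blast
    then obtain \<alpha>' where "\<alpha> = b * \<alpha>'" by (auto simp: dvd_def)
    have "a = a' + (of_int q *s e i + of_int p *s f i)" by (simp add: a'_def)
    then have "\<langle>a, x\<rangle> = of_int (b * (n + q + p * \<alpha>'))"
      using n \<alpha> x(2) \<open>\<alpha> = b * \<alpha>'\<close> by (simp add: form_linear algebra_simps)
    then show ?thesis by blast
  qed
  show thesis
  proof (rule that[of "nat b"])
    show "nat b > 0" using b by simp
    show "\<exists>x\<in>S. \<langle>e i, x\<rangle> = of_nat (nat b)" using ex b by simp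
    show "\<exists>n. \<langle>a, x\<rangle> = of_int (int (nat b) * n)" if "x \<in> S" "\<langle>e i, x\<rangle> = of_nat (nat b)" "a \<in> L" for x a
      using all that b by simp
  qed
qed

end

section \<open>Moving the polarization into standard position\<close>

lemma isometry_uminus: "uminus \<in> k3_isometries"
  by (rule isometryI[where h = uminus]) (auto simp: form_linear lattice_uminus)

lemma standard_frame: "hyperbolic_frame (\<lambda>i. axis (Inr (i, 0)) 1) (\<lambda>i. axis (Inr (i, 1)) 1)"
proof
  show "Re \<langle>x, x\<rangle> \<le> 0"
    if "conj_vec x = x" "\<And>i. \<langle>axis (Inr (i, 0)) 1, x\<rangle> = 0" "\<And>i. \<langle>axis (Inr (i, 1)) 1, x\<rangle> = 0" for x
  proof (rule negative_on_E8_part)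
    show "x $ Inr (i, a) = 0" for i a
    proof -
      have "a = 0 \<or> a = 1" using exhaust_2[of a] by auto
      then show ?thesis using that(2,3)[of i] by (auto simp: form_axis_hyperbolic)
    qed
  qed (fact that)
qed (simp_all add: lattice_axis form_axis_hyperbolic, simp_all add: axis_def)

lemma isometry_frame:
  assumes "hyperbolic_frame e f" "h \<in> k3_isometries"
  shows "hyperbolic_frame (\<lambda>i. h (e i)) (\<lambda>i. h (f i))"
proof -
  interpret hyperbolic_frame e f by fact
  note h = isometryD[OF assms(2)]
  let ?k = "inv_into UNIV h"
  have k: "?k \<in> k3_isometries" using assms(2) by (rule isometry_inv)
  have hk: "h (?k x) = x" for x using h(6) by (simp add: bij_is_surj surj_f_inv_f)
  show ?thesis
  proof
    show "Re \<langle>x, x\<rangle> \<le> 0"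
      if "conj_vec x = x" "\<And>i. \<langle>h (e i), x\<rangle> = 0" "\<And>i. \<langle>h (f i), x\<rangle> = 0" for x
    proof -
      have "conj_vec (?k x) = ?k x" using isometry_conj[OF k, of x] that(1) by simp
      moreover have "\<langle>e i, ?k x\<rangle> = 0" "\<langle>f i, ?k x\<rangle> = 0" for i
        using that(2,3)[of i] h(4)[of _ "?k x"] by (simp_all add: hk)
      ultimately have "Re \<langle>?k x, ?k x\<rangle> \<le> 0" by (rule frame_negative)
      then show ?thesis using isometryD(4)[OF k, of x x] by simp
    qed
  qed (simp_all add: h)
qed

text \<open>
  The standard position of a polarization of degree \<open>2 * m\<close>: it lies in the third plane, so the other
  two planes are contained in its orthogonal complement.
\<close>

locale polarized_frame = hyperbolic_frame +
  fixes l :: k3_space and m :: nat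
  assumes m_pos: "m > 0" and l_eq: "l = of_nat m *s e 2 + f 2"

text \<open>
  Primitive vectors of equal norm are equivalent under the isometries of the K3 lattice. The descent
  on the orbit of \<open>l\<close> yields a vector all of whose pairings are divisible by the minimal value \<open>\<beta>\<close>;
  unimodularity and primitivity force \<open>\<beta> = 1\<close>. One more transvection then moves the vector into a
  single plane, where its norm determines it.
\<close>

lemma exists_polarized_frame:
  assumes d: "even d" "d \<ge> 2" and prim: "primitive_in k3_lattice l" and norm: "\<langle>l, l\<rangle> = of_nat d"
  obtains e f where "polarized_frame e f l (d div 2)"
proof -
  obtain e f where "hyperbolic_frame e f" using standard_frame by blast
  then interpret hyperbolic_frame e f .
  define S where "S = {g l | g. g \<in> k3_isometries}"
  have l: "l \<in> k3_lattice" using prim by (simp add: primitive_in_def)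
  have S_isom: "g x \<in> S" if "x \<in> S" "g \<in> k3_isometries" for x g
  proof -
    obtain h where "x = h l" "h \<in> k3_isometries" using \<open>x \<in> S\<close> by (auto simp: S_def)
    then have "g x = (g \<circ> h) l" "g \<circ> h \<in> k3_isometries" using that isometry_comp by auto
    then show ?thesis unfolding S_def by blast
  qed
  have S_lat: "x \<in> k3_lattice" and S_norm: "\<langle>x, x\<rangle> = of_nat d" if "x \<in> S" for x
    using that l norm by (auto simp: S_def isometryD)
  have "l \<in> S" unfolding S_def using isometry_id by (metis (mono_tags, lifting) id_apply mem_Collect_eq)
  have t_e: "transvection (e 2) a x \<in> S" if "a \<in> k3_lattice" "\<langle>e 2, a\<rangle> = 0" "x \<in> S" for a x
    using that by (intro S_isom[OF that(3) transvection_isometry]) auto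
  have t_f: "transvection (f 2) a x \<in> S" if "a \<in> k3_lattice" "\<langle>f 2, a\<rangle> = 0" "x \<in> S" for a x
    using that by (intro S_isom[OF that(3) transvection_isometry]) auto
  \<comment> \<open>If \<open>e 2\<close> were orthogonal to the orbit, transvections along \<open>f 2\<close> would force \<open>l\<close> to be isotropic.\<close>
  have "\<exists>x\<in>S. \<langle>e 2, x\<rangle> \<noteq> 0"
  proof (rule ccontr)
    assume "\<not> (\<exists>x\<in>S. \<langle>e 2, x\<rangle> \<noteq> 0)"
    then have all: "\<langle>e 2, x\<rangle> = 0" if "x \<in> S" for x using that by blast
    have eq: "\<langle>a, l\<rangle> + \<langle>a, a\<rangle> / 2 * \<langle>f 2, l\<rangle> = 0"
      if "a \<in> k3_lattice" "\<langle>e 2, a\<rangle> = 0" "\<langle>f 2, a\<rangle> = 0" for a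
    proof -
      have "\<langle>e 2, transvection (f 2) a l\<rangle> = - (\<langle>a, l\<rangle> + \<langle>a, a\<rangle> / 2 * \<langle>f 2, l\<rangle>)"
        using that(2) all[OF \<open>l \<in> S\<close>] by (simp add: transvection_def form_linear)
      then show ?thesis
        using all[OF t_f[OF that(1,3) \<open>l \<in> S\<close>]] by (metis neg_equal_0_iff_equal)
    qed
    have "\<langle>e 0, l\<rangle> = 0" "\<langle>f 0, l\<rangle> = 0" using eq[of "e 0"] eq[of "f 0"] by simp_all
    then have "\<langle>f 2, l\<rangle> = 0" using eq[of "e 0 + f 0"] by (simp add: form_linear lattice_add)
    then have "\<langle>l, l\<rangle> = 0" using eq[OF l] all[OF \<open>l \<in> S\<close>] by simp
    then show False using norm d by simp
  qed
  then obtain x where x: "x \<in> S" "\<langle>e 2, x\<rangle> \<noteq> 0" by blast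
  obtain n where n: "\<langle>e 2, x\<rangle> = of_int n"
    using lattice_form_Ints[OF frame_lattice(1) S_lat[OF x(1)]] by (rule Ints_cases)
  obtain x0 n0 where start: "x0 \<in> S" "\<langle>e 2, x0\<rangle> = of_nat n0" "n0 > 0"
  proof (cases "n > 0")
    case True
    then show ?thesis using that[of x "nat n"] x n by simp
  next
    case False
    then show ?thesis using that[of "- x" "nat (- n)"] x n S_isom[OF x(1) isometry_uminus]
      by (simp add: form_linear)
  qed
  obtain \<beta> where \<beta>: "\<beta> > 0" "\<exists>x\<in>S. \<langle>e 2, x\<rangle> = of_nat \<beta>"
    "\<And>x a. \<lbrakk>x \<in> S; \<langle>e 2, x\<rangle> = of_nat \<beta>; a \<in> k3_lattice\<rbrakk> \<Longrightarrow> \<exists>n. \<langle>a, x\<rangle> = of_int (int \<beta> * n)"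
  proof (rule descent[of 2 0 k3_lattice S x0 n0])
    show "transvection (e 2) a x \<in> S" "transvection (f 2) a x \<in> S"
      if "a \<in> k3_lattice" "\<langle>e 2, a\<rangle> = 0" "\<langle>f 2, a\<rangle> = 0" "x \<in> S" for a x
      using that t_e t_f by blast+
  qed (use start in \<open>auto simp: lattice_add lattice_scale lattice_form_Ints S_lat\<close>)
  obtain y where y: "y \<in> S" "\<langle>e 2, y\<rangle> = of_nat \<beta>" using \<beta>(2) by blast
  obtain g where g: "g \<in> k3_isometries" "y = g l" using y by (auto simp: S_def)
  have "(1 / of_nat \<beta>) *s y \<in> k3_lattice"
  proof (rule k3_lattice_self_dual)
    fix a assume "a \<in> k3_lattice"
    then obtain n where "\<langle>a, y\<rangle> = of_int (int \<beta> * n)" using \<beta>(3)[OF y] by blast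
    then show "\<langle>a, (1 / of_nat \<beta>) *s y\<rangle> \<in> \<int>" using \<beta>(1) by (simp add: form_linear)
  qed
  then have "inv_into UNIV g ((1 / of_nat \<beta>) *s y) \<in> k3_lattice"
    by (rule isometryD(5)[OF isometry_inv[OF g(1)]])
  then have "(1 / of_nat \<beta>) *s l \<in> k3_lattice"
    using isometryD(6)[OF g(1)] isometryD(3)[OF isometry_inv[OF g(1)]] by (simp add: g bij_is_inj)
  moreover have "l = of_int (int \<beta>) *s ((1 / of_nat \<beta>) *s l)" using \<beta>(1) by simp
  ultimately have "int \<beta> = 1 \<or> int \<beta> = -1" using prim unfolding primitive_in_def by blast
  then have "\<beta> = 1" by simp
  \<comment> \<open>Minus the component of \<open>y\<close> orthogonal to the third plane; as \<open>\<langle>e 2, y\<rangle> = 1\<close>, the transvection removes it.\<close>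
  define a where "a = \<langle>f 2, y\<rangle> *s e 2 + f 2 - y"
  have "a \<in> k3_lattice" unfolding a_def
    by (intro lattice_diff lattice_add lattice_scale lattice_form_Ints frame_lattice S_lat[OF y(1)])
  then have a: "a \<in> k3_lattice" "\<langle>e 2, a\<rangle> = 0"
    using y(2) \<open>\<beta> = 1\<close> by (simp_all add: a_def form_linear)
  define c where "c = \<langle>f 2, y\<rangle> - (\<langle>a, y\<rangle> + \<langle>a, a\<rangle> / 2)"
  have t: "transvection (e 2) a y = c *s e 2 + f 2"
    using y(2) \<open>\<beta> = 1\<close> by (simp add: transvection_def c_def) (simp add: a_def vec_eq_iff algebra_simps)
  have "of_nat d = \<langle>c *s e 2 + f 2, c *s e 2 + f 2\<rangle>"
    using S_norm[OF t_e[OF a y(1)]] by (simp add: t)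
  then have "of_nat d = 2 * c" by (simp add: form_linear)
  moreover have "d = 2 * (d div 2)" using d by simp
  ultimately have "c = of_nat (d div 2)"
    by (metis mult_cancel_left of_nat_mult of_nat_numeral zero_neq_numeral)
  define h where "h = inv_into UNIV (transvection (e 2) a \<circ> g)"
  have tg: "transvection (e 2) a \<circ> g \<in> k3_isometries"
    using a g by (intro isometry_comp transvection_isometry) auto
  then have h: "h \<in> k3_isometries" unfolding h_def by (rule isometry_inv)
  have "h (c *s e 2 + f 2) = l"
    using inv_f_f[OF bij_is_inj[OF isometryD(6)[OF tg]], of l] t g(2) by (simp add: h_def)
  then have l_eq: "l = c *s h (e 2) + h (f 2)" by (simp add: isometryD[OF h])
  interpret h: hyperbolic_frame "\<lambda>i. h (e i)" "\<lambda>i. h (f i)"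
    by (rule isometry_frame) (unfold_locales, fact h)
  have "polarized_frame (\<lambda>i. h (e i)) (\<lambda>i. h (f i)) l (d div 2)"
    using d l_eq \<open>c = of_nat (d div 2)\<close> by unfold_locales auto
  then show thesis by (rule that)
qed

section \<open>Cosets in additive groups of vectors\<close>

definition coset :: "k3_space set \<Rightarrow> k3_space \<Rightarrow> k3_space set" where
  "coset H a = (\<lambda>h. h + a) ` H"

lemma coset_eqI:
  assumes "\<And>x y. x \<in> H \<Longrightarrow> y \<in> H \<Longrightarrow> x + y \<in> H" "\<And>x y. x \<in> H \<Longrightarrow> y \<in> H \<Longrightarrow> x - y \<in> H"
    and "a - b \<in> H"
  shows "coset H a = coset H b"
proof -
  have "coset H x \<subseteq> coset H y" if "x - y \<in> H" for x y
    using assms(1)[OF _ that] by (force simp: coset_def image_iff)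
  moreover have "b - a \<in> H" using assms(2)[OF assms(2)[OF assms(3,3)] assms(3)] by simp
  ultimately show ?thesis using assms(3) by blast
qed

lemma carrier_quotient: "carrier (additive_group A Mod H) = coset H ` A"
  by (auto simp: FactGroup_def RCOSETS_def r_coset_def additive_group_def coset_def)

lemma additive_comm_group:
  assumes "0 \<in> A" "\<And>x y. x \<in> A \<Longrightarrow> y \<in> A \<Longrightarrow> x + y \<in> A" "\<And>x. x \<in> A \<Longrightarrow> - x \<in> A"
  shows "comm_group (additive_group A)"
proof (rule comm_groupI)
  show "\<exists>y\<in>carrier (additive_group A). y \<otimes>\<^bsub>additive_group A\<^esub> x = \<one>\<^bsub>additive_group A\<^esub>"
    if "x \<in> carrier (additive_group A)" for x
    using that assms(3) by (intro bexI[of _ "- x"]) (simp_all add: additive_group_def)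
qed (use assms in \<open>simp_all add: additive_group_def add_ac\<close>)

lemma quotient_order_iff:
  assumes A: "0 \<in> A" "\<And>x y. x \<in> A \<Longrightarrow> y \<in> A \<Longrightarrow> x + y \<in> A" "\<And>x. x \<in> A \<Longrightarrow> - x \<in> A"
    and H: "0 \<in> H" "\<And>x y. x \<in> H \<Longrightarrow> y \<in> H \<Longrightarrow> x + y \<in> H" "\<And>x. x \<in> H \<Longrightarrow> - x \<in> H"
    and "H \<subseteq> A" "a \<in> A"
  shows "group.ord (additive_group A Mod H) (coset H a) = r \<longleftrightarrow> (\<forall>n. of_nat n *s a \<in> H \<longleftrightarrow> r dvd n)"
proof -
  let ?A = "additive_group A"
  interpret A: comm_group ?A by (rule additive_comm_group) (fact A)+
  have sub: "subgroup H ?A"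
  proof (rule A.subgroupI)
    show "inv\<^bsub>?A\<^esub> x \<in> H" if "x \<in> H" for x
    proof -
      have "inv\<^bsub>?A\<^esub> x = - x"
        using that \<open>H \<subseteq> A\<close> A(3) by (intro A.inv_equality) (auto simp: additive_group_def)
      then show ?thesis using H(3) that by simp
    qed
  qed (use H \<open>H \<subseteq> A\<close> in \<open>auto simp: additive_group_def\<close>)
  then have normal: "H \<lhd> ?A" by (rule A.subgroup_imp_normal)
  interpret Q: group "?A Mod H" by (rule normal.factorgroup_is_group[OF normal])
  have coset: "coset H x = H #>\<^bsub>?A\<^esub> x" for x
    by (auto simp: coset_def r_coset_def additive_group_def)
  have a: "a \<in> carrier ?A" using \<open>a \<in> A\<close> by (simp add: additive_group_def)
  have pow: "a [^]\<^bsub>?A\<^esub> n = of_nat n *s a" for n :: nat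
    by (induction n) (simp_all add: additive_group_def nat_pow_def vec_eq_iff algebra_simps)
  have qpow: "coset H a [^]\<^bsub>?A Mod H\<^esub> n = coset H (of_nat n *s a)" for n :: nat
    using hom_nat_pow[OF normal.r_coset_hom_Mod[OF normal] a A.is_group Q.is_group, of n]
    by (simp add: coset pow)
  have one: "coset H (of_nat n *s a) = H \<longleftrightarrow> of_nat n *s a \<in> H" for n
    using A.nat_pow_closed[OF a, of n] A.coset_join1[OF _ _ sub] A.coset_join2[OF _ sub]
    unfolding pow coset by metis
  have "coset H a \<in> carrier (?A Mod H)" using \<open>a \<in> A\<close> by (simp add: carrier_quotient)
  from Q.pow_eq_id[OF this] have ord: "of_nat n *s a \<in> H \<longleftrightarrow> Q.ord (coset H a) dvd n" for n
    by (simp add: qpow one)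
  show ?thesis unfolding ord by (meson dvd_antisym dvd_refl)
qed

section \<open>The polarized lattice and its stable isometries\<close>

context polarized_frame
begin

abbreviation "L \<equiv> polarized_lattice l"
abbreviation "D \<equiv> dual_lattice L"

lemma frame_l [simp]:
  "\<langle>e i, l\<rangle> = (if i = 2 then 1 else 0)" "\<langle>f i, l\<rangle> = (if i = 2 then of_nat m else 0)"
  "\<langle>l, e i\<rangle> = (if i = 2 then 1 else 0)" "\<langle>l, f i\<rangle> = (if i = 2 then of_nat m else 0)"
  "\<langle>l, l\<rangle> = 2 * of_nat m"
  by (simp_all add: l_eq form_linear)

lemma l_lattice [simp]: "l \<in> k3_lattice"
  unfolding l_eq by (intro lattice_add lattice_scale) auto

lemma L_sub: "L \<subseteq> k3_lattice"
  by (auto simp: polarized_lattice_def)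

lemma L_orth: "x \<in> L \<Longrightarrow> \<langle>x, l\<rangle> = 0" "x \<in> L \<Longrightarrow> \<langle>l, x\<rangle> = 0"
  by (auto simp: polarized_lattice_def form_sym)

lemma L_closed: "0 \<in> L" "x \<in> L \<Longrightarrow> y \<in> L \<Longrightarrow> x + y \<in> L" "x \<in> L \<Longrightarrow> y \<in> L \<Longrightarrow> x - y \<in> L"
  "x \<in> L \<Longrightarrow> c \<in> \<int> \<Longrightarrow> c *s x \<in> L"
  by (auto simp: polarized_lattice_def form_linear intro: lattice_add lattice_diff lattice_scale lattice_0)

lemma frame_L [simp]: "e 0 \<in> L" "f 0 \<in> L" "e 1 \<in> L" "f 1 \<in> L"
  by (simp_all add: polarized_lattice_def)

text \<open>
  Orthogonal projection along \<open>l\<close>. The dual of \<open>L\<close> turns out to be the projection of the whole K3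
  lattice, which is the form in which it is used below.
\<close>

definition proj :: "k3_space \<Rightarrow> k3_space" where
  "proj x = x - (\<langle>x, l\<rangle> / (2 * of_nat m)) *s l"

lemma proj_orth: "\<langle>proj x, l\<rangle> = 0"
  using m_pos by (simp add: proj_def form_linear)

lemma proj_form: "\<langle>y, l\<rangle> = 0 \<Longrightarrow> \<langle>y, proj x\<rangle> = \<langle>y, x\<rangle>"
  by (simp add: proj_def form_linear)

lemma proj_linear: "proj (x + y) = proj x + proj y" "proj (c *s x) = c *s proj x"
  by (simp_all add: proj_def form_linear vec_eq_iff algebra_simps add_divide_distrib)

lemma proj_id: "\<langle>x, l\<rangle> = 0 \<Longrightarrow> proj x = x"
  by (simp add: proj_def)

lemma multiple_in_L:
  assumes "x \<in> k3_lattice"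
  shows "(2 * of_nat m) *s proj x \<in> L"
proof -
  have "(2 * of_nat m) *s proj x = (2 * of_nat m) *s x - \<langle>x, l\<rangle> *s l"
    using m_pos by (simp add: proj_def vec_eq_iff algebra_simps)
  moreover have "\<dots> \<in> k3_lattice" using assms
    by (intro lattice_diff lattice_scale lattice_form_Ints l_lattice) auto
  ultimately show ?thesis by (simp add: polarized_lattice_def form_linear proj_orth)
qed

lemma proj_dual:
  assumes "x \<in> k3_lattice"
  shows "proj x \<in> D"
proof -
  have "proj x \<in> rational_span L"
    unfolding rational_span_def using multiple_in_L[OF assms] m_pos
    by (intro CollectI exI[of _ "2 * m"]) simp
  moreover have "\<langle>proj x, y\<rangle> \<in> \<int>" if "y \<in> L" for y
    using that lattice_form_Ints[of y x] assms L_sub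
    by (subst form_sym) (auto simp: proj_form L_orth)
  ultimately show ?thesis by (simp add: dual_lattice_def)
qed

lemma dual_orth:
  assumes "w \<in> D"
  shows "\<langle>w, l\<rangle> = 0"
proof -
  obtain n :: nat where "n > 0" "of_nat n *s w \<in> L" using assms by (auto simp: dual_lattice_def rational_span_def)
  then show ?thesis using L_orth(1)[of "of_nat n *s w"] by (simp add: form_linear)
qed

lemma dual_form: "w \<in> D \<Longrightarrow> y \<in> L \<Longrightarrow> \<langle>w, y\<rangle> \<in> \<int>" "w \<in> D \<Longrightarrow> y \<in> L \<Longrightarrow> \<langle>y, w\<rangle> \<in> \<int>"
  by (auto simp: dual_lattice_def form_sym)

text \<open>
  A functional on \<open>L\<close> is glued to a functional on the K3 lattice by correcting it with a multiple of
  \<open>l\<close>. The right multiple is read off from the pairing \<open>k\<close> with \<open>f 2 - m e 2\<close>, the generator of the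
  orthogonal complement of \<open>l\<close> in the third plane; the corrected vector then pairs to \<open>0\<close> and \<open>k\<close> with
  \<open>e 2\<close> and \<open>f 2\<close>.
\<close>

lemma dual_lift:
  assumes "w \<in> D"
  obtains x where "x \<in> k3_lattice" "w = proj x"
proof -
  define k where "k = \<langle>f 2 - of_nat m *s e 2, w\<rangle>"
  define x where "x = w + (k / (2 * of_nat m)) *s l"
  have "f 2 - of_nat m *s e 2 \<in> k3_lattice"
    by (intro lattice_diff lattice_scale frame_lattice) simp
  then have "f 2 - of_nat m *s e 2 \<in> L"
    by (simp add: polarized_lattice_def form_linear)
  then have k: "k \<in> \<int>" unfolding k_def by (rule dual_form(2)[OF assms])
  have "\<langle>l, w\<rangle> = 0" using dual_orth[OF assms] by (simp add: form_sym)
  then have "of_nat m * \<langle>e 2, w\<rangle> + \<langle>f 2, w\<rangle> = 0" by (simp add: l_eq form_linear)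
  then have w2: "\<langle>f 2, w\<rangle> = - (of_nat m * \<langle>e 2, w\<rangle>)" by (simp add: add_eq_0_iff)
  then have k_eq: "k = - 2 * of_nat m * \<langle>e 2, w\<rangle>" by (simp add: k_def form_linear)
  have x2: "\<langle>e 2, x\<rangle> = 0" "\<langle>f 2, x\<rangle> = k"
    using m_pos by (simp_all add: x_def form_linear w2 k_eq)
  have "x \<in> k3_lattice"
  proof (rule k3_lattice_self_dual)
    fix y assume y: "y \<in> k3_lattice"
    define y0 where "y0 = y - (\<langle>f 2, y\<rangle> *s e 2 + \<langle>e 2, y\<rangle> *s f 2)"
    have "y0 \<in> k3_lattice" unfolding y0_def
      by (intro lattice_diff lattice_add lattice_scale lattice_form_Ints frame_lattice y)
    moreover have "\<langle>l, y0\<rangle> = 0" by (simp add: y0_def l_eq form_linear)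
    ultimately have y0: "y0 \<in> L" by (simp add: polarized_lattice_def form_sym)
    have "y = y0 + \<langle>f 2, y\<rangle> *s e 2 + \<langle>e 2, y\<rangle> *s f 2" by (simp add: y0_def)
    then have "\<langle>y, x\<rangle> = \<langle>y0, x\<rangle> + \<langle>e 2, y\<rangle> * k"
      by (metis (no_types, lifting) add.right_neutral form_add_left form_scale_left mult_zero_right x2)
    moreover have "\<langle>y0, x\<rangle> = \<langle>y0, w\<rangle>" using L_orth[OF y0] by (simp add: x_def form_linear)
    moreover have "\<langle>e 2, y\<rangle> \<in> \<int>" by (intro lattice_form_Ints frame_lattice y)
    ultimately show "\<langle>y, x\<rangle> \<in> \<int>" using k dual_form(2)[OF assms y0] by simp
  qed
  moreover have "w = proj x"
    using dual_orth[OF assms] m_pos by (simp add: x_def proj_def form_linear)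
  ultimately show thesis by (rule that)
qed

lemma dual_iff: "w \<in> D \<longleftrightarrow> w \<in> proj ` k3_lattice"
  using dual_lift proj_dual by blast

lemma dual_closed: "0 \<in> D" "x \<in> D \<Longrightarrow> y \<in> D \<Longrightarrow> x + y \<in> D" "x \<in> D \<Longrightarrow> y \<in> D \<Longrightarrow> x - y \<in> D"
  "x \<in> D \<Longrightarrow> - x \<in> D" "x \<in> D \<Longrightarrow> c \<in> \<int> \<Longrightarrow> c *s x \<in> D"
proof -
  show sc: "c *s x \<in> D" if x: "x \<in> D" and c: "c \<in> \<int>" for c x
  proof -
    obtain y where "y \<in> k3_lattice" "x = proj y" using x by (rule dual_lift)
    then show ?thesis using proj_dual[OF lattice_scale[OF _ c]] by (simp add: proj_linear)
  qed
  show add: "x + y \<in> D" if x: "x \<in> D" and y: "y \<in> D" for x y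
  proof -
    obtain x' where "x' \<in> k3_lattice" "x = proj x'" using x by (rule dual_lift)
    moreover obtain y' where "y' \<in> k3_lattice" "y = proj y'" using y by (rule dual_lift)
    ultimately show ?thesis using proj_dual[OF lattice_add] by (simp add: proj_linear)
  qed
  show neg: "- x \<in> D" if "x \<in> D" for x using sc[OF that, of "-1"] by simp
  show "x - y \<in> D" if "x \<in> D" "y \<in> D" for x y using add[OF that(1) neg[OF that(2)]] by simp
  show "0 \<in> D" using proj_dual[OF lattice_0] by (simp add: proj_def form_linear)
qed

lemma L_dual: "L \<subseteq> D"
proof
  fix x assume "x \<in> L"
  then show "x \<in> D" using proj_dual[of x] proj_id[OF L_orth(1)] L_sub by auto
qed

lemma dual_divide:
  assumes "w \<in> D" "n > (0::nat)" "\<And>y. y \<in> L \<Longrightarrow> \<langle>y, w\<rangle> / of_nat n \<in> \<int>"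
  shows "(1 / of_nat n) *s w \<in> D"
proof -
  obtain k :: nat where "k > 0" "of_nat k *s w \<in> L"
    using assms(1) by (auto simp: dual_lattice_def rational_span_def)
  then have "(1 / of_nat n) *s w \<in> rational_span L" unfolding rational_span_def using assms(2)
    by (intro CollectI exI[of _ "k * n"]) auto
  moreover have "\<langle>(1 / of_nat n) *s w, y\<rangle> \<in> \<int>" if "y \<in> L" for y
    using assms(3)[OF that] by (simp add: form_linear form_sym)
  ultimately show ?thesis by (simp add: dual_lattice_def)
qed

text \<open>
  The isometries of the K3 lattice fixing the polarization. Unlike a general
  isometry of \<open>L\<close>, they act on the K3 lattice itself, where transvections are available.
\<close>

definition G :: "(k3_space \<Rightarrow> k3_space) set" where
  "G = {g \<in> k3_isometries. g l = l}"

lemma G_isometry: "g \<in> G \<Longrightarrow> g \<in> k3_isometries"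
  by (simp add: G_def)

lemma G_comp: "g \<in> G \<Longrightarrow> h \<in> G \<Longrightarrow> g \<circ> h \<in> G"
  by (simp add: G_def isometry_comp)

lemma G_id: "id \<in> G"
  by (simp add: G_def isometry_id)

lemma G_inv: "g \<in> G \<Longrightarrow> inv_into UNIV g \<in> G"
  using inv_f_eq[OF bij_is_inj[OF isometryD(6)], of g l l] by (simp add: G_def isometry_inv)

lemma G_inv_apply:
  assumes "g \<in> G"
  shows "g (inv_into UNIV g x) = x" "inv_into UNIV g (g x) = x"
  using isometryD(6)[OF G_isometry[OF assms]] by (simp_all add: bij_is_surj surj_f_inv_f bij_is_inj)

lemma G_transvection:
  assumes "\<langle>u, u\<rangle> = 0" "\<langle>u, a\<rangle> = 0" "u \<in> L" "a \<in> L"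
  shows "transvection u a \<in> G"
  unfolding G_def using assms L_sub
  by (auto simp: L_orth transvection_fixes intro!: transvection_isometry)

lemma G_proj: "g \<in> G \<Longrightarrow> g (proj x) = proj (g x)"
  using isometryD(4)[of g x l] by (simp add: G_def proj_def isometryD(2,3))

lemma G_L: "g \<in> G \<Longrightarrow> x \<in> L \<Longrightarrow> g x \<in> L"
  using isometryD(4)[of g x l] by (simp add: G_def polarized_lattice_def isometryD(5))

lemma G_dual: "g \<in> G \<Longrightarrow> x \<in> D \<Longrightarrow> g x \<in> D"
  unfolding dual_iff by (auto simp: G_proj isometryD(5)[OF G_isometry])

lemma G_dual_iff: "g \<in> G \<Longrightarrow> g x \<in> D \<longleftrightarrow> x \<in> D"
  using G_dual[of g x] G_dual[OF G_inv, of g "g x"] by (auto simp: G_inv_apply)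

lemma G_image_dual: "g \<in> G \<Longrightarrow> g ` D = D"
  using G_dual G_dual_iff[of g "inv_into UNIV g _"] by (force simp: G_inv_apply image_iff)

lemma G_image_L: "g \<in> G \<Longrightarrow> g ` L = L"
  using G_L G_L[OF G_inv] by (force simp: G_inv_apply image_iff)

lemma G_coset: "g \<in> G \<Longrightarrow> g ` coset D x = coset D (g x)"
  by (subst (2) G_image_dual[symmetric, of g])
    (simp_all add: coset_def image_image isometryD(1)[OF G_isometry])

lemma orthogonal_complement_L:
  assumes "\<And>y. y \<in> L \<Longrightarrow> \<langle>x, y\<rangle> = 0"
  shows "x = (\<langle>x, l\<rangle> / (2 * of_nat m)) *s l"
proof -
  have "proj x = 0"
  proof (rule k3_form_nondegenerate)
    fix y assume "y \<in> k3_lattice"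
    then have "\<langle>x, (2 * of_nat m) *s proj y\<rangle> = 0" using assms multiple_in_L by blast
    then have "\<langle>proj y, x\<rangle> = 0" using m_pos by (simp add: form_linear form_sym)
    then have "\<langle>proj y, proj x\<rangle> = 0" by (simp add: proj_form proj_orth)
    then show "\<langle>y, proj x\<rangle> = 0"
      by (metis form_sym proj_form proj_orth)
  qed
  then show ?thesis by (simp add: proj_def)
qed

text \<open>
  An element \<open>proj x\<close> of the dual lattice moves by \<open>g x - x\<close>, which is a lattice vector orthogonal to \<open>l\<close>;
  hence \<open>g\<close> acts trivially on the discriminant group.
\<close>

lemma G_stable:
  assumes "g \<in> G"
  shows "g \<in> stable_isometries L"
proof -
  note g = isometryD[OF G_isometry[OF assms]]
  have gl: "g l = l" using assms by (simp add: G_def)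
  have "inj_on g L" using g(6) by (meson bij_is_inj inj_on_subset subset_UNIV)
  then have "bij_betw g L L" using G_image_L[OF assms] by (simp add: bij_betw_def)
  moreover have "g x = x" if "\<forall>y\<in>L. \<langle>x, y\<rangle> = 0" for x
    using orthogonal_complement_L[of x] that by (metis g(3) gl)
  ultimately have "g \<in> lattice_isometries L"
    by (simp add: lattice_isometries_def linear_k3_iff g)
  moreover have "g ` coset L w = coset L w" if w: "w \<in> D" for w
  proof -
    obtain x where x: "x \<in> k3_lattice" "w = proj x" using w by (rule dual_lift)
    have "g w - w = g x - x"
      using g(4)[of x l] by (simp add: x(2) G_proj[OF assms]) (simp add: proj_def gl)
    moreover have "\<dots> \<in> L"
      using g(4)[of x l] x(1) g(5) by (simp add: gl polarized_lattice_def form_linear lattice_diff)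
    ultimately have "g w - w \<in> L" by simp
    with L_closed(2,3) have "coset L (g w) = coset L w" by (rule coset_eqI)
    moreover have "g ` coset L w = coset L (g w)"
      by (subst (2) G_image_L[OF assms, symmetric]) (simp add: coset_def image_image g)
    ultimately show ?thesis by simp
  qed
  ultimately show ?thesis
    by (auto simp: stable_isometries_def discriminant_group_def carrier_quotient)
qed

lemma stable_comp:
  assumes "g \<in> stable_isometries L" "h \<in> stable_isometries L"
  shows "g \<circ> h \<in> stable_isometries L"
proof -
  have "\<langle>g (h x), g (h y)\<rangle> = \<langle>x, y\<rangle>" if "x \<in> L" "y \<in> L" for x y
  proof -
    have "h ` L = L" using assms(2) by (simp add: stable_isometries_def lattice_isometries_def bij_betw_def)
    then have "h x \<in> L" "h y \<in> L" using that by blast+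
    then show ?thesis using assms that by (simp add: stable_isometries_def lattice_isometries_def)
  qed
  moreover have "g (h x) = x" if "\<forall>y\<in>L. \<langle>x, y\<rangle> = 0" for x
    using assms that by (auto simp: stable_isometries_def lattice_isometries_def)
  ultimately have "g \<circ> h \<in> lattice_isometries L"
    using assms by (auto simp: stable_isometries_def lattice_isometries_def linear_k3_iff intro: bij_betw_trans)
  moreover have "(g \<circ> h) ` c = c" if "c \<in> carrier (discriminant_group L)" for c
    using assms that unfolding stable_isometries_def image_comp[symmetric] by simp
  ultimately show ?thesis by (simp add: stable_isometries_def)
qed

lemma stable_orbit_G:
  assumes "g \<in> G"
  shows "stable_orbit l (g ` p, g ` v) = stable_orbit l (p, v)"
proof -
  have "stable_orbit l (k ` p, k ` v) \<subseteq> stable_orbit l (p, v)" if "k \<in> G" for k p v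
  proof
    fix z assume "z \<in> stable_orbit l (k ` p, k ` v)"
    then obtain h where "h \<in> stable_isometries L" "z = (h ` k ` p, h ` k ` v)"
      by (auto simp: stable_orbit_def)
    then have "h \<circ> k \<in> stable_isometries L" "z = ((h \<circ> k) ` p, (h \<circ> k) ` v)"
      using stable_comp[OF _ G_stable[OF \<open>k \<in> G\<close>]] by (simp_all add: image_comp)
    then show "z \<in> stable_orbit l (p, v)" unfolding stable_orbit_def by blast
  qed
  from this[OF assms, of p v] this[OF G_inv[OF assms], of "g ` p" "g ` v"] show ?thesis
    by (simp add: image_image G_inv_apply[OF assms])
qed

section \<open>Normal forms of torsion classes\<close>

text \<open>
  Elements of \<open>(1/r) D / D\<close> are represented by vectors of \<open>D\<close>, which matter only modulo \<open>r D\<close>.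
\<close>

definition torsion_class :: "nat \<Rightarrow> k3_space \<Rightarrow> k3_space set" where
  "torsion_class r w = coset D ((1 / of_nat r) *s w)"

text \<open>
  Since \<open>proj (e 2)\<close> generates \<open>D\<close> modulo \<open>L\<close>, the coefficient \<open>k\<close> is the class in the discriminant group,
  and \<open>n\<close> then determines the norm: these are the two invariants of the Eichler criterion.
\<close>

definition normal_vector :: "int \<Rightarrow> int \<Rightarrow> k3_space" where
  "normal_vector n k = of_int n *s e 0 + f 0 + of_int k *s proj (e 2)"

lemma torsion_class_eqI:
  assumes "r > 0" "u \<in> D" "w = w' + of_nat r *s u"
  shows "torsion_class r w = torsion_class r w'"
  unfolding torsion_class_def
proof (rule coset_eqI)
  have "(1 / of_nat r) *s w - (1 / of_nat r) *s w' = u"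
    using assms by (simp add: vec_eq_iff field_simps)
  then show "(1 / of_nat r) *s w - (1 / of_nat r) *s w' \<in> D" using assms(2) by simp
qed (fact dual_closed(2,3))+

lemma G_torsion_class: "g \<in> G \<Longrightarrow> g ` torsion_class r w = torsion_class r (g w)"
  by (simp add: torsion_class_def G_coset isometryD(3)[OF G_isometry])

lemma order_elements_iff:
  assumes "r > 0"
  shows "v \<in> order_elements l r \<longleftrightarrow>
    (\<exists>w\<in>D. v = torsion_class r w \<and> (\<forall>n. (of_nat n / of_nat r) *s w \<in> D \<longleftrightarrow> r dvd n))"
proof -
  let ?A = "(\<lambda>x. (1 / of_nat r) *s x) ` D"
  have ord: "group.ord (additive_group ?A Mod D) (torsion_class r w) = r \<longleftrightarrow>
      (\<forall>n. (of_nat n / of_nat r) *s w \<in> D \<longleftrightarrow> r dvd n)" if w: "w \<in> D" for w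
  proof -
    have "group.ord (additive_group ?A Mod D) (coset D ((1 / of_nat r) *s w)) = r \<longleftrightarrow>
      (\<forall>n. of_nat n *s ((1 / of_nat r) *s w) \<in> D \<longleftrightarrow> r dvd n)"
    proof (rule quotient_order_iff)
      show "0 \<in> ?A" using dual_closed(1) by force
      show "x + y \<in> ?A" if xy: "x \<in> ?A" "y \<in> ?A" for x y
      proof -
        obtain a b where "a \<in> D" "b \<in> D" "x = (1 / of_nat r) *s a" "y = (1 / of_nat r) *s b" using xy by blast
        then show ?thesis using dual_closed(2)[of a b] by (intro image_eqI[of _ _ "a + b"]) (simp_all add: vec_eq_iff algebra_simps)
      qed
      show "- x \<in> ?A" if x: "x \<in> ?A" for x
      proof -
        obtain a where "a \<in> D" "x = (1 / of_nat r) *s a" using x by blast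
        then show ?thesis using dual_closed(4)[of a] by (intro image_eqI[of _ _ "- a"]) (simp_all add: vec_eq_iff)
      qed
      show "D \<subseteq> ?A"
      proof
        fix x assume "x \<in> D"
        then show "x \<in> ?A" using dual_closed(5)[of x "of_nat r"] assms
          by (intro image_eqI[of _ _ "of_nat r *s x"]) (simp_all add: vec_eq_iff)
      qed
      show "(1 / of_nat r) *s w \<in> ?A" using w by blast
    qed (fact dual_closed)+
    then show ?thesis by (simp add: torsion_class_def)
  qed
  show ?thesis
  proof
    assume "v \<in> order_elements l r"
    then have v: "v \<in> coset D ` ?A" "group.ord (additive_group ?A Mod D) v = r"
      by (simp_all add: order_elements_def torsion_dual_def carrier_quotient Let_def)
    then obtain w where w: "w \<in> D" "v = torsion_class r w" by (auto simp: torsion_class_def)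
    then show "\<exists>w\<in>D. v = torsion_class r w \<and> (\<forall>n. (of_nat n / of_nat r) *s w \<in> D \<longleftrightarrow> r dvd n)"
      using ord[OF w(1)] v(2) by blast
  next
    assume "\<exists>w\<in>D. v = torsion_class r w \<and> (\<forall>n. (of_nat n / of_nat r) *s w \<in> D \<longleftrightarrow> r dvd n)"
    then obtain w where w: "w \<in> D" "v = torsion_class r w"
      "\<forall>n. (of_nat n / of_nat r) *s w \<in> D \<longleftrightarrow> r dvd n" by blast
    have "torsion_class r w \<in> coset D ` ?A" unfolding torsion_class_def using w(1) by blast
    then show "v \<in> order_elements l r"
      using ord[OF w(1)] w(2,3) by (simp add: order_elements_def torsion_dual_def carrier_quotient Let_def)
  qed
qed

lemma G_order_elements:
  assumes "g \<in> G" "v \<in> order_elements l r" "r > 0"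
  shows "g ` v \<in> order_elements l r"
proof -
  obtain w where w: "w \<in> D" "v = torsion_class r w" "\<forall>n. (of_nat n / of_nat r) *s w \<in> D \<longleftrightarrow> r dvd n"
    using assms(2) order_elements_iff[OF assms(3)] by blast
  have "(of_nat n / of_nat r) *s g w \<in> D \<longleftrightarrow> (of_nat n / of_nat r) *s w \<in> D" for n
    using G_dual_iff[OF assms(1), of "(of_nat n / of_nat r) *s w"] by (simp add: isometryD(3)[OF G_isometry[OF assms(1)]])
  then show ?thesis
    using w G_dual[OF assms(1) w(1)] G_torsion_class[OF assms(1)] order_elements_iff[OF assms(3)] by auto
qed

text \<open>
  The descent applied to all representatives of the orbit of \<open>w\<close> modulo \<open>r D\<close>. The minimal value \<open>\<beta>\<close>
  divides all pairings with \<open>L\<close>, so a minimal representative is \<open>\<beta>\<close> times a dual vector. Adding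
  \<open>r\<close> times \<open>e 1\<close> gives another minimal representative, whose pairing with \<open>f 1\<close> differs by \<open>r\<close>, so \<open>\<beta>\<close>
  divides \<open>r\<close>. Then \<open>r / \<beta>\<close> annihilates the
  class, and its order being \<open>r\<close> leaves only \<open>\<beta> = 1\<close>.
\<close>

lemma unit_pairing:
  assumes r: "r > 0" and w: "w \<in> D" and ord: "\<And>n. (of_nat n / of_nat r) *s w \<in> D \<Longrightarrow> r dvd n"
  obtains g u where "g \<in> G" "u \<in> D" "\<langle>e 0, g w + of_nat r *s u\<rangle> = 1"
proof -
  define S where "S = {g w + of_nat r *s u | g u. g \<in> G \<and> u \<in> D}"
  have SI: "g w + of_nat r *s u \<in> S" if "g \<in> G" "u \<in> D" for g u
    using that by (auto simp: S_def)
  have S_G: "h x \<in> S" if x: "x \<in> S" and h: "h \<in> G" for x h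
  proof -
    obtain g u where "x = g w + of_nat r *s u" "g \<in> G" "u \<in> D" using x by (auto simp: S_def)
    then show ?thesis using SI[OF G_comp[OF h] G_dual[OF h], of g u] by (simp add: isometryD[OF G_isometry[OF h]])
  qed
  have S_add: "x + of_nat r *s u \<in> S" if x: "x \<in> S" and u: "u \<in> D" for x u
  proof -
    obtain g u' where "x = g w + of_nat r *s u'" "g \<in> G" "u' \<in> D" using x by (auto simp: S_def)
    moreover from this have "x + of_nat r *s u = g w + of_nat r *s (u' + u)"
      by (simp add: vec.scale_right_distrib)
    ultimately show ?thesis using SI[OF _ dual_closed(2)[OF _ u], of g u'] by metis
  qed
  have S_dual: "x \<in> D" if x: "x \<in> S" for x
  proof -
    obtain g u where "x = g w + of_nat r *s u" "g \<in> G" "u \<in> D" using x by (auto simp: S_def)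
    then show ?thesis using dual_closed(2)[OF G_dual[OF _ w] dual_closed(5)] by simp
  qed
  have wS: "w \<in> S" using SI[OF G_id dual_closed(1)] by simp
  obtain n where n: "\<langle>e 0, w\<rangle> = of_int n" using dual_form(2)[OF w frame_L(1)] by (rule Ints_cases)
  \<comment> \<open>A multiple of \<open>r\<close> large enough to make the pairing with \<open>e 0\<close> positive.\<close>
  define s where "s = int r * (\<bar>n\<bar> + 1)"
  define n0 where "n0 = n + s"
  have "1 * (\<bar>n\<bar> + 1) \<le> s" unfolding s_def by (rule mult_right_mono) (use r in auto)
  then have "\<bar>n\<bar> + 1 \<le> s" by simp
  then have "n0 > 0" unfolding n0_def by (simp add: abs_if split: if_splits)
  have s0: "w + of_nat r *s (of_int (\<bar>n\<bar> + 1) *s f 0) \<in> S"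
    using L_dual by (intro S_add wS dual_closed(5)) auto
  have s1: "\<langle>e 0, w + of_nat r *s (of_int (\<bar>n\<bar> + 1) *s f 0)\<rangle> = of_nat (nat n0)"
    using \<open>n0 > 0\<close> n by (simp add: form_linear n0_def s_def algebra_simps)
  obtain \<beta> where \<beta>: "\<beta> > 0" "\<exists>x\<in>S. \<langle>e 0, x\<rangle> = of_nat \<beta>"
    "\<And>x a. \<lbrakk>x \<in> S; \<langle>e 0, x\<rangle> = of_nat \<beta>; a \<in> L\<rbrakk> \<Longrightarrow> \<exists>n. \<langle>a, x\<rangle> = of_int (int \<beta> * n)"
  proof (rule descent[of 0 1 L S "w + of_nat r *s (of_int (\<bar>n\<bar> + 1) *s f 0)" "nat n0"])
    show "transvection (e 0) a x \<in> S" "transvection (f 0) a x \<in> S"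
      if "a \<in> L" "\<langle>e 0, a\<rangle> = 0" "\<langle>f 0, a\<rangle> = 0" "x \<in> S" for a x
      using that by (auto intro!: S_G[OF that(4)] G_transvection)
    show "\<langle>a, x\<rangle> \<in> \<int>" if "a \<in> L" "x \<in> S" for a x using dual_form(2)[OF S_dual] that by blast
    show "0 < nat n0" using \<open>n0 > 0\<close> by simp
  qed (use s0 s1 L_sub in \<open>simp_all add: L_closed\<close>)
  obtain x where x: "x \<in> S" "\<langle>e 0, x\<rangle> = of_nat \<beta>" using \<beta>(2) by blast
  have "\<beta> dvd r"
  proof -
    have x': "x + of_nat r *s e 1 \<in> S" "\<langle>e 0, x + of_nat r *s e 1\<rangle> = of_nat \<beta>"
      using x L_dual by (auto intro!: S_add simp: form_linear)
    obtain i where i: "\<langle>f 1, x\<rangle> = of_int (int \<beta> * i)" using \<beta>(3)[OF x, of "f 1"] by auto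
    obtain j where j: "\<langle>f 1, x + of_nat r *s e 1\<rangle> = of_int (int \<beta> * j)" using \<beta>(3)[OF x', of "f 1"] by auto
    have "of_int (int \<beta> * i + int r) = (of_int (int \<beta> * j) :: complex)"
      using i j by (simp add: form_linear)
    then have "int \<beta> * i + int r = int \<beta> * j" by (simp only: of_int_eq_iff)
    then have "int r = int \<beta> * (j - i)" by (simp add: algebra_simps)
    then show ?thesis by (metis dvd_triv_left int_dvd_int_iff)
  qed
  then obtain r' where r': "r = \<beta> * r'" by (auto simp: dvd_def)
  obtain g u where gu: "x = g w + of_nat r *s u" "g \<in> G" "u \<in> D" using x by (auto simp: S_def)
  have "(1 / of_nat \<beta>) *s x \<in> D"
  proof (rule dual_divide)
    fix y assume "y \<in> L"
    then obtain k where "\<langle>y, x\<rangle> = of_int (int \<beta> * k)" using \<beta>(3)[OF x] by blast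
    then show "\<langle>y, x\<rangle> / of_nat \<beta> \<in> \<int>" using \<beta>(1) by simp
  qed (use x S_dual \<beta> in auto)
  then have "(1 / of_nat \<beta>) *s x - of_nat r' *s u \<in> D"
    by (rule dual_closed(3)) (intro dual_closed(5) gu(3), simp)
  also have "(1 / of_nat \<beta>) *s x - of_nat r' *s u = g ((of_nat r' / of_nat r) *s w)"
    using \<beta>(1) r unfolding isometryD(3)[OF G_isometry[OF gu(2)]]
    by (simp add: gu(1) r' vec_eq_iff field_simps)
  finally have "r dvd r'" using ord G_dual_iff[OF gu(2)] by blast
  then have "r \<le> r'" using r r' by (intro dvd_imp_le) auto
  moreover have "r' > 0" using r r' by auto
  ultimately have "\<beta> = 1" using r' \<beta>(1) by (cases \<beta>) auto
  then show thesis using that gu x by simp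
qed

text \<open>
  Once the pairing with \<open>e 0\<close> is \<open>1\<close>, a transvection along \<open>e 0\<close> removes any vector of \<open>L\<close> from the part
  orthogonal to the first plane. What is left there is \<open>k0\<close> times \<open>proj (e 2)\<close>, where \<open>k0\<close> changes by
  multiples of \<open>2 * m\<close> through transvections and by multiples of \<open>r\<close> through the choice of
  representative, hence matters only modulo the greatest common divisor of both.
\<close>

lemma normal_form:
  assumes r: "r > 0" and v: "v \<in> order_elements l r"
  obtains g n k where "g \<in> G" "0 \<le> n" "n < int r" "0 \<le> k" "k < int (gcd r (2 * m))"
    "g ` v = torsion_class r (normal_vector n k)"
proof -
  obtain w where w: "w \<in> D" "v = torsion_class r w"
    and ord: "\<forall>n. (of_nat n / of_nat r) *s w \<in> D \<longleftrightarrow> r dvd n"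
    using v order_elements_iff[OF r] by blast
  obtain g u where g: "g \<in> G" and u: "u \<in> D" and unit: "\<langle>e 0, g w + of_nat r *s u\<rangle> = 1"
  proof (rule unit_pairing[OF r w(1)])
    show "r dvd n" if "(of_nat n / of_nat r) *s w \<in> D" for n using ord that by blast
  qed
  define x where "x = g w + of_nat r *s u"
  have x: "x \<in> D" unfolding x_def by (intro dual_closed(2,5) G_dual[OF g w(1)] u) simp
  obtain y where y: "y \<in> k3_lattice" "x = proj y" using x by (rule dual_lift)
  have yl: "\<langle>y, l\<rangle> \<in> \<int>" using y by (intro lattice_form_Ints) auto
  then obtain k0 where k0: "\<langle>y, l\<rangle> = of_int k0" by (rule Ints_cases)
  define c where "c = gcd (int r) (2 * int m)"
  define k where "k = k0 mod c"
  have "c > 0" using r by (simp add: c_def)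
  obtain i j where ij: "i * int r + j * (2 * int m) = c"
    unfolding c_def using bezout_int by blast
  have fx: "\<langle>f 0, x\<rangle> \<in> \<int>" by (rule dual_form(2)[OF x frame_L(2)])
  have ex: "\<langle>e 0, x\<rangle> = 1" using unit by (simp add: x_def)
  then have yx: "\<langle>e 0, y\<rangle> = 1" "\<langle>f 0, y\<rangle> = \<langle>f 0, x\<rangle>" by (simp_all add: y(2) proj_form)
  define q where "q = k0 div c"
  have kq: "k0 = k + q * (i * int r + j * (2 * int m))" unfolding k_def q_def ij by simp
  \<comment> \<open>The vector of \<open>L\<close> in the third plane; it is \<open>- 2 * m\<close> times \<open>proj (e 2)\<close>.\<close>
  define l' where "l' = l - (2 * of_nat m) *s e 2"
  have l'_L: "l' \<in> L"
  proof -
    have "l' \<in> k3_lattice" unfolding l'_def by (intro lattice_diff lattice_scale l_lattice frame_lattice) simp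
    then show ?thesis by (simp add: polarized_lattice_def l'_def form_linear)
  qed
  have l'_proj: "l' = - (2 * of_nat m) *s proj (e 2)"
    using m_pos by (simp add: l'_def proj_def vec_eq_iff field_simps)
  define a where "a = - (y - \<langle>f 0, x\<rangle> *s e 0 - f 0 - of_int k0 *s e 2) + of_int (q * j) *s l'"
  have "y - \<langle>f 0, x\<rangle> *s e 0 - f 0 - of_int k0 *s e 2 \<in> k3_lattice"
    by (intro lattice_diff lattice_scale y frame_lattice fx) simp
  then have "y - \<langle>f 0, x\<rangle> *s e 0 - f 0 - of_int k0 *s e 2 \<in> L"
    by (simp add: polarized_lattice_def form_linear k0)
  from L_closed(3)[OF L_closed(1) this] have a: "a \<in> L"
    unfolding a_def by (intro L_closed(2,4) l'_L) simp_all
  have a0: "\<langle>e 0, a\<rangle> = 0" using yx by (simp add: a_def form_linear l'_def)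
  define t where "t = transvection (e 0) a"
  have t: "t \<in> G" unfolding t_def using a a0 by (intro G_transvection) auto
  have ax: "\<langle>a, x\<rangle> \<in> \<int>" by (rule dual_form(2)[OF x a])
  have a2: "\<langle>a, a\<rangle> / 2 \<in> \<int>" using a L_sub by (intro lattice_form_even) auto
  define s where "s = \<langle>a, x\<rangle> + \<langle>a, a\<rangle> / 2"
  obtain n0 where "\<langle>f 0, x\<rangle> - s = of_int n0"
    using Ints_diff[OF fx Ints_add[OF ax a2]] unfolding s_def by (rule Ints_cases)
  then have n0: "\<langle>f 0, x\<rangle> = of_int n0 + s" by (simp add: algebra_simps)
  have pa: "a = - (x - \<langle>f 0, x\<rangle> *s e 0 - f 0 - of_int k0 *s proj (e 2)) + of_int (q * j) *s l'"
  proof -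
    have "proj a = a" using L_orth(1)[OF a] by (rule proj_id)
    moreover have "proj (- z) = - proj z" "proj (z - z') = proj z - proj z'" for z z'
      using proj_linear(2)[of "-1" z] proj_linear(1)[of "z - z'" z'] by (simp_all add: algebra_simps)
    moreover have "proj l' = l'" using L_orth(1)[OF l'_L] by (rule proj_id)
    moreover have "proj (e 0) = e 0" "proj (f 0) = f 0" by (simp_all add: proj_id)
    ultimately show ?thesis using y(2) by (simp add: a_def proj_linear)
  qed
  have tx: "t x = of_int n0 *s e 0 + f 0 + of_int (k + q * i * int r) *s proj (e 2)"
  proof -
    have "t x = (x + a) - s *s e 0"
      by (simp add: t_def transvection_def ex s_def)
    also have "x + a = \<langle>f 0, x\<rangle> *s e 0 + f 0 + of_int (k0 - q * j * (2 * int m)) *s proj (e 2)"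
      by (subst pa) (simp add: l'_proj vec_eq_iff algebra_simps)
    also have "k0 - q * j * (2 * int m) = k + q * i * int r" by (simp add: kq algebra_simps)
    finally show ?thesis by (simp add: n0 vec_eq_iff algebra_simps)
  qed
  define n where "n = n0 mod int r"
  have n0_eq: "n0 = n + n0 div int r * int r" by (simp add: n_def)
  have pe: "proj (e 2) \<in> D" by (intro proj_dual) simp
  have "(t \<circ> g) ` v = torsion_class r (t (g w))"
    using G_torsion_class[OF G_comp[OF t g]] w(2) by simp
  also have "\<dots> = torsion_class r (t x)"
    by (rule torsion_class_eqI[OF r, of "- t u"])
      (use G_dual[OF t u] dual_closed(4) in \<open>simp_all add: x_def isometryD[OF G_isometry[OF t]] vec_eq_iff\<close>)
  also have "\<dots> = torsion_class r (normal_vector n k)"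
  proof (rule torsion_class_eqI[OF r])
    show "of_int (n0 div int r) *s e 0 + of_int (q * i) *s proj (e 2) \<in> D"
      by (intro dual_closed(2,5) pe subsetD[OF L_dual] frame_L) simp_all
    show "t x = normal_vector n k + of_nat r *s (of_int (n0 div int r) *s e 0 + of_int (q * i) *s proj (e 2))"
      unfolding tx by (subst n0_eq) (simp add: normal_vector_def vec_eq_iff algebra_simps)
  qed
  finally have "(t \<circ> g) ` v = torsion_class r (normal_vector n k)" .
  moreover have "0 \<le> n" "n < int r" "0 \<le> k" "k < c"
    using r \<open>c > 0\<close> by (simp_all add: n_def k_def)
  moreover have "c = int (gcd r (2 * m))" unfolding c_def by (simp flip: gcd_int_int_eq)
  ultimately show thesis using that[OF G_comp[OF t g]] by blast
qed

end

section \<open>Imaginary parts and complex lines\<close>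

definition im_vec :: "k3_space \<Rightarrow> k3_space" where
  "im_vec x = (\<chi> i. of_real (Im (x $ i)))"

lemma im_vec_eq: "im_vec x = (- \<i> / 2) *s (x - conj_vec x)"
  by (simp add: im_vec_def conj_vec_def vec_eq_iff complex_eq_iff)

lemma im_vec_real: "conj_vec (im_vec x) = im_vec x"
  by (simp add: im_vec_def conj_vec_def vec_eq_iff)

lemma form_im_vec:
  assumes "conj_vec y = y"
  shows "\<langle>y, im_vec x\<rangle> = of_real (Im \<langle>y, x\<rangle>)"
proof -
  have "\<langle>y, conj_vec x\<rangle> = cnj \<langle>y, x\<rangle>" using form_conj[of y x] assms by simp
  then show ?thesis by (simp add: im_vec_eq form_linear complex_eq_iff)
qed

lemma form_im_vec_im_vec: "Re \<langle>im_vec x, im_vec x\<rangle> = (Re \<langle>x, conj_vec x\<rangle> - Re \<langle>x, x\<rangle>) / 2"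
proof -
  have "\<langle>conj_vec x, x\<rangle> = \<langle>x, conj_vec x\<rangle>" "\<langle>conj_vec x, conj_vec x\<rangle> = cnj \<langle>x, x\<rangle>"
    by (simp_all add: form_sym form_conj)
  then show ?thesis by (simp add: im_vec_eq form_linear field_simps)
qed

lemma form_real: "conj_vec x = x \<Longrightarrow> conj_vec y = y \<Longrightarrow> \<langle>x, y\<rangle> = of_real (Re \<langle>x, y\<rangle>)"
  using form_conj[of x y] by (simp add: complex_eq_iff)

lemma line_eq: "line x = range (\<lambda>k. k *s x)"
  by (simp add: line_def vec.span_singleton)

lemma line_scale:
  assumes "c \<noteq> 0"
  shows "line (c *s x) = line x"
proof -
  have "k *s x \<in> line (c *s x)" for k
    unfolding line_eq using assms by (intro range_eqI[of _ _ "k / c"]) simp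
  moreover have "k *s (c *s x) \<in> line x" for k
    unfolding line_eq by (intro range_eqI[of _ _ "k * c"]) simp
  ultimately show ?thesis by (auto simp: line_eq)
qed

section \<open>The marked period space\<close>

context polarized_frame
begin

lemma conj_frame [simp]: "conj_vec (e i) = e i" "conj_vec (f i) = f i" "conj_vec l = l"
  by (simp_all add: conj_lattice)

text \<open>
  On the orthogonal complement of \<open>l\<close> the form has only two positive directions, and a vector orthogonal to the isotropic
  vectors \<open>e 0\<close> and \<open>e 1\<close> sees neither of them: the first two planes contribute nothing to its norm, and
  orthogonality to \<open>l\<close> makes the third contribute \<open>- 2 * m\<close> times a square.
\<close>

lemma negative_semidefinite:
  assumes y: "conj_vec y = y" and "\<langle>l, y\<rangle> = 0" "\<langle>e 0, y\<rangle> = 0" "\<langle>e 1, y\<rangle> = 0"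
  shows "Re \<langle>y, y\<rangle> \<le> 0"
proof -
  have re: "\<langle>e i, y\<rangle> = of_real (Re \<langle>e i, y\<rangle>)" "\<langle>f i, y\<rangle> = of_real (Re \<langle>f i, y\<rangle>)" for i
    using y by (intro form_real; simp)+
  define a where "a = Re \<langle>e 2, y\<rangle>"
  define b0 where "b0 = Re \<langle>f 0, y\<rangle>"
  define b1 where "b1 = Re \<langle>f 1, y\<rangle>"
  have e2: "\<langle>e 2, y\<rangle> = of_real a" and f0: "\<langle>f 0, y\<rangle> = of_real b0" and f1: "\<langle>f 1, y\<rangle> = of_real b1"
    unfolding a_def b0_def b1_def by (fact re)+
  have f2: "\<langle>f 2, y\<rangle> = of_real (- m * a)"
    using assms(2) by (simp add: l_eq form_linear e2 add_eq_0_iff)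
  have sym: "\<langle>y, e 0\<rangle> = 0" "\<langle>y, e 1\<rangle> = 0" "\<langle>y, e 2\<rangle> = of_real a" "\<langle>y, f 0\<rangle> = of_real b0"
    "\<langle>y, f 1\<rangle> = of_real b1" "\<langle>y, f 2\<rangle> = of_real (- m * a)"
    using assms(3,4) e2 f0 f1 f2 by (metis form_sym)+
  define z where "z = y - of_real b0 *s e 0 - of_real b1 *s e 1 - of_real (- m * a) *s e 2 - of_real a *s f 2"
  have "Re \<langle>z, z\<rangle> \<le> 0"
  proof (rule frame_negative)
    show "conj_vec z = z" by (simp add: z_def conj_vec_simps y)
    have i: "i = 0 \<or> i = 1 \<or> i = 2" for i :: 3 using exhaust_3[of i] by auto
    show "\<langle>e i, z\<rangle> = 0" "\<langle>f i, z\<rangle> = 0" for i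
      using i[of i] by (auto simp: z_def form_linear assms e2 f0 f1 f2)
  qed
  moreover have yy: "\<langle>y, y\<rangle> = \<langle>z, z\<rangle> - of_real (2 * m * a\<^sup>2)"
    by (simp add: z_def form_linear sym assms e2 f0 f1 f2 power2_eq_square algebra_simps)
  have "Re \<langle>y, y\<rangle> = Re \<langle>z, z\<rangle> - 2 * m * a\<^sup>2"
    unfolding yy minus_complex.sel Re_complex_of_real ..
  moreover have "2 * m * a\<^sup>2 \<ge> 0" by simp
  ultimately show ?thesis by linarith
qed

lemma span_L_orth: "x \<in> vec.span L \<Longrightarrow> \<langle>l, x\<rangle> = 0"
  by (induction rule: vec.span_induct_alt) (simp_all add: form_linear L_orth)

text \<open>
  The imaginary part of \<open>x\<close> has half the positive norm \<open>\<langle>x, conj_vec x\<rangle>\<close>, so it cannot be orthogonal to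
  both \<open>e 0\<close> and \<open>e 1\<close>. This both allows every period to be normalized and splits the
  period domain into two halves, by the sign of the imaginary part of \<open>\<langle>e 1, x\<rangle>\<close>.
\<close>

lemma isotropic_line_im:
  assumes "\<langle>l, x\<rangle> = 0" "\<langle>x, x\<rangle> = 0" "Re \<langle>x, conj_vec x\<rangle> > 0" "Im \<langle>e 0, x\<rangle> = 0"
  shows "Im \<langle>e 1, x\<rangle> \<noteq> 0"
proof
  assume "Im \<langle>e 1, x\<rangle> = 0"
  then have "Re \<langle>im_vec x, im_vec x\<rangle> \<le> 0"
    using assms by (intro negative_semidefinite im_vec_real) (simp_all add: form_im_vec)
  then show False using assms by (simp add: form_im_vec_im_vec)
qed

definition normalized :: "k3_space \<Rightarrow> bool" where
  "normalized x \<longleftrightarrow> x \<in> vec.span L \<and> \<langle>e 0, x\<rangle> = 1 \<and> \<langle>x, x\<rangle> = 0 \<and> Re \<langle>x, conj_vec x\<rangle> > 0"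

lemma normalized_nonzero: "normalized x \<Longrightarrow> x \<noteq> 0"
  by (auto simp: normalized_def form_zero)

lemma normalized_period: "normalized x \<Longrightarrow> line x \<in> period_domain L"
  using normalized_nonzero[of x] unfolding normalized_def period_domain_def by blast

lemma period_normalized:
  assumes "p \<in> period_domain L"
  obtains x where "p = line x" "normalized x"
proof -
  obtain y where y: "p = line y" "y \<in> vec.span L" "\<langle>y, y\<rangle> = 0" "Re \<langle>y, conj_vec y\<rangle> > 0"
    using assms unfolding period_domain_def by blast
  have scale: "Re \<langle>c *s y, conj_vec (c *s y)\<rangle> = (cmod c)\<^sup>2 * Re \<langle>y, conj_vec y\<rangle>" for c
  proof -
    have "\<langle>c *s y, conj_vec (c *s y)\<rangle> = (c * cnj c) * \<langle>y, conj_vec y\<rangle>"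
      by (simp add: conj_vec_simps form_linear)
    also have "c * cnj c = of_real ((cmod c)\<^sup>2)" by (rule complex_norm_square[symmetric])
    finally show ?thesis by simp
  qed
  have nz: "\<langle>e 0, y\<rangle> \<noteq> 0"
  proof
    assume 0: "\<langle>e 0, y\<rangle> = 0"
    \<comment> \<open>A rotation of \<open>y\<close> makes its pairing with \<open>e 1\<close> real as well.\<close>
    define c where "c = (if \<langle>e 1, y\<rangle> = 0 then 1 else cnj \<langle>e 1, y\<rangle>)"
    have "c \<noteq> 0" by (simp add: c_def)
    have "Im \<langle>e 1, c *s y\<rangle> \<noteq> 0"
    proof (rule isotropic_line_im)
      show "Re \<langle>c *s y, conj_vec (c *s y)\<rangle> > 0" using y(4) \<open>c \<noteq> 0\<close> by (simp only: scale) simp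
    qed (simp_all add: form_linear y 0 span_L_orth)
    then show False by (simp add: c_def form_linear split: if_splits)
  qed
  define c where "c = 1 / \<langle>e 0, y\<rangle>"
  have "c \<noteq> 0" using nz by (simp add: c_def)
  show thesis
  proof (rule that)
    show "p = line (c *s y)" by (simp add: line_scale \<open>c \<noteq> 0\<close> y(1))
    have "Re \<langle>c *s y, conj_vec (c *s y)\<rangle> > 0" using y(4) \<open>c \<noteq> 0\<close> by (simp only: scale) simp
    then show "normalized (c *s y)" using nz y
      unfolding normalized_def by (simp add: form_linear c_def vec.span_scale)
  qed
qed

definition upper_half :: "k3_space set set" where
  "upper_half = {p \<in> marked_periods L. \<exists>x. p = line x \<and> normalized x \<and> Im \<langle>e 1, x\<rangle> > 0}"

lemma G_line:
  assumes "g \<in> G"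
  shows "g ` line x = line (g x)"
  by (simp add: line_eq image_image isometryD(3)[OF G_isometry[OF assms]])

lemma G_span:
  assumes "g \<in> G" "x \<in> vec.span L"
  shows "g x \<in> vec.span L"
  using assms(2)
proof (induction rule: vec.span_induct_alt)
  case base
  show ?case using isometryD(3)[OF G_isometry[OF assms(1)], of 0 0] by (simp add: vec.span_zero)
next
  case (step c x y)
  then show ?case using G_L[OF assms(1)]
    by (simp add: isometryD[OF G_isometry[OF assms(1)]] vec.span_add vec.span_scale vec.span_base)
qed

lemma G_marked:
  assumes g: "g \<in> G" and p: "p \<in> marked_periods L"
  shows "g ` p \<in> marked_periods L"
proof -
  note gi = isometryD[OF G_isometry[OF g]]
  have "p \<in> period_domain L" using p by (simp add: marked_periods_def)
  then obtain x where x: "p = line x" "normalized x" by (rule period_normalized)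
  have gx: "g x \<in> vec.span L" "\<langle>g x, g x\<rangle> = 0" "Re \<langle>g x, conj_vec (g x)\<rangle> > 0"
    using x(2) G_span[OF g] by (simp_all add: normalized_def gi isometry_conj[OF G_isometry[OF g], symmetric])
  then have "g x \<noteq> 0" by (auto simp: form_zero)
  then have "line (g x) \<in> period_domain L" using gx unfolding period_domain_def by blast
  moreover have "\<not> (\<forall>z\<in>line (g x). \<langle>z, \<delta>\<rangle> = 0)" if \<delta>: "\<delta> \<in> L" "\<langle>\<delta>, \<delta>\<rangle> = -2" for \<delta>
  proof
    let ?h = "inv_into UNIV g"
    have h: "?h \<in> G" using g by (rule G_inv)
    assume "\<forall>z\<in>line (g x). \<langle>z, \<delta>\<rangle> = 0"
    then have "\<langle>z, ?h \<delta>\<rangle> = 0" if "z \<in> line x" for z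
      using that gi(4)[of z "?h \<delta>"] by (simp add: G_inv_apply[OF g] flip: G_line[OF g])
    moreover have "?h \<delta> \<in> L" "\<langle>?h \<delta>, ?h \<delta>\<rangle> = -2"
      using G_L[OF h] \<delta> by (simp_all add: isometryD(4)[OF G_isometry[OF h]])
    ultimately show False using p x(1) by (auto simp: marked_periods_def)
  qed
  ultimately show ?thesis by (simp add: x(1) G_line[OF g] marked_periods_def)
qed

section \<open>Exchanging the two halves of the period space\<close>

text \<open>
  Minus the identity on the second plane. It fixes the normal vectors, which are orthogonal to that
  plane, but changes the sign of the pairing with \<open>e 1\<close> that separates the two halves.
\<close>

definition flip :: "k3_space \<Rightarrow> k3_space" where
  "flip x = x - (2 * \<langle>f 1, x\<rangle>) *s e 1 - (2 * \<langle>e 1, x\<rangle>) *s f 1"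

lemma flip_G: "flip \<in> G"
proof -
  have "flip \<in> k3_isometries"
  proof (rule isometryI[where h = flip])
    show "\<langle>flip x, flip y\<rangle> = \<langle>x, y\<rangle>" for x y
    proof -
      have "\<langle>x, e 1\<rangle> = \<langle>e 1, x\<rangle>" "\<langle>x, f 1\<rangle> = \<langle>f 1, x\<rangle>" by (simp_all add: form_sym)
      then show ?thesis by (simp add: flip_def form_linear algebra_simps)
    qed
    show lat: "flip x \<in> k3_lattice" if "x \<in> k3_lattice" for x
      unfolding flip_def using that
      by (intro lattice_diff lattice_scale Ints_mult lattice_form_Ints frame_lattice) auto
    then show "flip x \<in> k3_lattice" if "x \<in> k3_lattice" for x using that .
    show "flip (flip x) = x" for x
      by (simp add: flip_def form_linear vec_eq_iff algebra_simps)
    then show "flip (flip x) = x" for x .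
  qed (simp_all add: flip_def form_linear vec_eq_iff algebra_simps)
  moreover have "flip l = l" by (simp add: flip_def)
  ultimately show ?thesis by (simp add: G_def)
qed

lemma flip_normal_vector: "flip (normal_vector n k) = normal_vector n k"
  by (simp add: flip_def normal_vector_def proj_def form_linear)

lemma upper_half_or_flip:
  assumes "p \<in> marked_periods L"
  shows "p \<in> upper_half \<or> flip ` p \<in> upper_half"
proof -
  have "p \<in> period_domain L" using assms by (simp add: marked_periods_def)
  then obtain x where x: "p = line x" "normalized x" by (rule period_normalized)
  have "Im \<langle>e 1, x\<rangle> \<noteq> 0"
    using x(2) by (intro isotropic_line_im) (simp_all add: normalized_def span_L_orth)
  moreover have "p \<in> upper_half" if "Im \<langle>e 1, x\<rangle> > 0"
    using assms x that unfolding upper_half_def by blast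
  moreover have "flip ` p \<in> upper_half" if "Im \<langle>e 1, x\<rangle> < 0"
  proof -
    have "\<langle>e 0, flip x\<rangle> = \<langle>e 0, x\<rangle>" "\<langle>e 1, flip x\<rangle> = - \<langle>e 1, x\<rangle>"
      by (simp_all add: flip_def form_linear)
    moreover have "normalized (flip x)"
      using x(2) G_span[OF flip_G] calculation
      by (simp add: normalized_def isometryD(4)[OF G_isometry[OF flip_G]]
          isometry_conj[OF G_isometry[OF flip_G], symmetric])
    ultimately show ?thesis
      using G_marked[OF flip_G assms] that unfolding upper_half_def x(1) G_line[OF flip_G] by auto
  qed
  ultimately show ?thesis by linarith
qed

end

section \<open>Connectedness of a half\<close>

lemma continuous_on_k3_form:
  assumes "continuous_on S u" "continuous_on S v"
  shows "continuous_on S (\<lambda>t. \<langle>u t, v t\<rangle>)"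
  unfolding k3_form_def by (intro continuous_intros assms)

lemma continuous_on_scale:
  fixes c :: "'a::topological_space \<Rightarrow> complex" and u :: "'a \<Rightarrow> k3_space"
  assumes "continuous_on S c" "continuous_on S u"
  shows "continuous_on S (\<lambda>t. c t *s u t)"
  unfolding vector_scalar_mult_def by (intro continuous_intros assms)

lemma continuous_on_im_vec:
  assumes "continuous_on S u"
  shows "continuous_on S (\<lambda>t. im_vec (u t))"
  unfolding im_vec_def by (intro continuous_intros assms)

lemma finite_quadratic_zeros:
  fixes a b c :: complex
  assumes "a \<noteq> 0"
  shows "finite {t. a + b * t + c * t\<^sup>2 = 0}"
proof -
  have "[:a, b, c:] \<noteq> 0" using assms by simp
  from poly_roots_finite[OF this] show ?thesis
    by (simp add: power2_eq_square algebra_simps)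
qed

context polarized_frame
begin

text \<open>
  The real vectors of positive norm orthogonal to \<open>l\<close> and \<open>e 0\<close>, among which the imaginary parts of
  normalized periods lie, form two opposite cones. The sign of \<open>\<langle>e 1, u\<rangle>\<close> selects one of them.
\<close>

definition cone :: "k3_space set" where
  "cone = {u. conj_vec u = u \<and> \<langle>l, u\<rangle> = 0 \<and> \<langle>e 0, u\<rangle> = 0 \<and> Re \<langle>e 1, u\<rangle> > 0 \<and> Re \<langle>u, u\<rangle> > 0}"

text \<open>
  The reverse Cauchy-Schwarz inequality. The combination \<open>w\<close> of \<open>u\<close> and \<open>v\<close> is orthogonal to \<open>e 1\<close>, so its
  norm is at most \<open>0\<close>; expanding that norm bounds \<open>\<langle>u, v\<rangle>\<close> from below.
\<close>

lemma positive_cone: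
  assumes "u \<in> cone" "v \<in> cone"
  shows "Re \<langle>u, v\<rangle> > 0"
proof -
  have u: "conj_vec u = u" "\<langle>l, u\<rangle> = 0" "\<langle>e 0, u\<rangle> = 0" "Re \<langle>e 1, u\<rangle> > 0" "Re \<langle>u, u\<rangle> > 0"
    and v: "conj_vec v = v" "\<langle>l, v\<rangle> = 0" "\<langle>e 0, v\<rangle> = 0" "Re \<langle>e 1, v\<rangle> > 0" "Re \<langle>v, v\<rangle> > 0"
    using assms by (simp_all add: cone_def)
  define a where "a = Re \<langle>e 1, u\<rangle>"
  define b where "b = Re \<langle>e 1, v\<rangle>"
  have ab: "a > 0" "b > 0" using u v by (simp_all add: a_def b_def)
  have e: "\<langle>e 1, u\<rangle> = of_real a" "\<langle>e 1, v\<rangle> = of_real b"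
    unfolding a_def b_def using u(1) v(1) by (intro form_real; simp)+
  define w where "w = of_real b *s u - of_real a *s v"
  have "Re \<langle>w, w\<rangle> \<le> 0"
    by (rule negative_semidefinite) (simp_all add: w_def conj_vec_simps form_linear u v e)
  moreover have "\<langle>w, w\<rangle> = of_real (b\<^sup>2) * \<langle>u, u\<rangle> - of_real (2 * a * b) * \<langle>u, v\<rangle> + of_real (a\<^sup>2) * \<langle>v, v\<rangle>"
    using form_sym[of v u] by (simp add: w_def form_linear power2_eq_square algebra_simps)
  ultimately have "b\<^sup>2 * Re \<langle>u, u\<rangle> + a\<^sup>2 * Re \<langle>v, v\<rangle> \<le> 2 * a * b * Re \<langle>u, v\<rangle>"
    by simp
  moreover have "b\<^sup>2 * Re \<langle>u, u\<rangle> > 0" "a\<^sup>2 * Re \<langle>v, v\<rangle> > 0" using ab u v by simp_all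
  ultimately have "2 * a * b * Re \<langle>u, v\<rangle> > 0" by linarith
  then show ?thesis by (rule zero_less_mult_pos) (simp add: ab)
qed

lemma cone_convex:
  assumes "u \<in> cone" "v \<in> cone" "a \<ge> 0" "b \<ge> 0" "a + b = (1::real)"
  shows "of_real a *s u + of_real b *s v \<in> cone"
proof -
  have uv: "Re \<langle>u, v\<rangle> > 0" using positive_cone assms(1,2) .
  have "a > 0 \<or> b > 0" using assms by linarith
  have "\<langle>of_real a *s u + of_real b *s v, of_real a *s u + of_real b *s v\<rangle>
      = of_real (a\<^sup>2) * \<langle>u, u\<rangle> + of_real (2 * a * b) * \<langle>u, v\<rangle> + of_real (b\<^sup>2) * \<langle>v, v\<rangle>"
    using form_sym[of v u] by (simp add: form_linear power2_eq_square algebra_simps)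
  then have "Re \<langle>of_real a *s u + of_real b *s v, of_real a *s u + of_real b *s v\<rangle>
      = a\<^sup>2 * Re \<langle>u, u\<rangle> + 2 * a * b * Re \<langle>u, v\<rangle> + b\<^sup>2 * Re \<langle>v, v\<rangle>"
    by simp
  also have "\<dots> > 0"
  proof -
    have nn: "a\<^sup>2 * Re \<langle>u, u\<rangle> \<ge> 0" "2 * a * b * Re \<langle>u, v\<rangle> \<ge> 0" "b\<^sup>2 * Re \<langle>v, v\<rangle> \<ge> 0"
      using assms uv by (auto simp: cone_def)
    have "a\<^sup>2 * Re \<langle>u, u\<rangle> > 0 \<or> b\<^sup>2 * Re \<langle>v, v\<rangle> > 0"
      using \<open>a > 0 \<or> b > 0\<close> assms by (auto simp: cone_def)
    then show ?thesis using nn by linarith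
  qed
  moreover have "Re \<langle>e 1, of_real a *s u + of_real b *s v\<rangle> > 0"
  proof -
    have nn: "a * Re \<langle>e 1, u\<rangle> \<ge> 0" "b * Re \<langle>e 1, v\<rangle> \<ge> 0" using assms by (auto simp: cone_def)
    have "a * Re \<langle>e 1, u\<rangle> > 0 \<or> b * Re \<langle>e 1, v\<rangle> > 0"
      using \<open>a > 0 \<or> b > 0\<close> assms by (auto simp: cone_def)
    then have "a * Re \<langle>e 1, u\<rangle> + b * Re \<langle>e 1, v\<rangle> > 0" using nn by linarith
    then show ?thesis by (simp add: form_linear)
  qed
  ultimately show ?thesis using assms(1,2) unfolding cone_def by (simp add: conj_vec_simps form_linear)
qed

text \<open>
  Adding a multiple of \<open>e 0\<close> makes any vector with \<open>\<langle>e 0, y\<rangle> = 1\<close> isotropic and leaves the norm of its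
  imaginary part unchanged. This is the tube domain model of the period domain.
\<close>

definition isotropic_lift :: "k3_space \<Rightarrow> k3_space" where
  "isotropic_lift y = y - (\<langle>y, y\<rangle> / 2) *s e 0"

lemma isotropic_lift_normalized:
  assumes "y \<in> vec.span L" "\<langle>e 0, y\<rangle> = 1" "im_vec y \<in> cone"
  shows "normalized (isotropic_lift y)" "Im \<langle>e 1, isotropic_lift y\<rangle> > 0"
proof -
  have y0: "\<langle>y, e 0\<rangle> = 1" using assms(2) by (simp add: form_sym)
  have yc: "\<langle>e 0, conj_vec y\<rangle> = 1" using form_conj[of "e 0" y] assms(2) by simp
  define c where "c = \<langle>y, y\<rangle> / 2"
  have cc: "\<langle>y, y\<rangle> = 2 * c" by (simp add: c_def)
  have "\<langle>isotropic_lift y, isotropic_lift y\<rangle> = 0"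
    by (simp add: isotropic_lift_def form_linear assms y0)
  moreover have "\<langle>e 0, isotropic_lift y\<rangle> = 1" "\<langle>e 1, isotropic_lift y\<rangle> = \<langle>e 1, y\<rangle>"
    by (simp_all add: isotropic_lift_def form_linear assms)
  moreover have "isotropic_lift y \<in> vec.span L"
    unfolding isotropic_lift_def
    by (rule vec.span_diff[OF assms(1)]) (intro vec.span_scale vec.span_base frame_L)
  moreover have "\<langle>isotropic_lift y, conj_vec (isotropic_lift y)\<rangle> = \<langle>y, conj_vec y\<rangle> - cnj c - c"
    unfolding isotropic_lift_def cc by (simp add: form_linear conj_vec_simps y0 yc)
  then have "Re \<langle>isotropic_lift y, conj_vec (isotropic_lift y)\<rangle> = 2 * Re \<langle>im_vec y, im_vec y\<rangle>"
    by (simp add: form_im_vec_im_vec cc)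
  moreover have "Re \<langle>im_vec y, im_vec y\<rangle> > 0" using assms(3) by (simp add: cone_def)
  moreover have "Im \<langle>e 1, y\<rangle> > 0" using assms(3) form_im_vec[of "e 1" y] by (simp add: cone_def)
  ultimately show "normalized (isotropic_lift y)" "Im \<langle>e 1, isotropic_lift y\<rangle> > 0"
    by (simp_all add: normalized_def)
qed

lemma topspace_marked_moduli: "topspace (marked_moduli l) = marked_periods L"
proof -
  have "p \<in> line ` (vec.span L - {0})" if "p \<in> marked_periods L" for p
    using that by (auto simp: marked_periods_def period_domain_def)
  then show ?thesis by (auto simp: marked_moduli_def Let_def projective_space_def)
qed

text \<open>
  In the tube domain the two periods are joined by a complex line, which meets the tube in a convex
  open set \<open>T\<close> of parameters. Along the line, the equation of each removed hyperplane is a polynomial of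
  degree at most two that does not vanish at the start, so it has finitely many zeros. Altogether
  countably many parameters are removed from a connected open subset of the plane, and
  the remaining set \<open>T - B\<close> is still connected.
\<close>

lemma upper_half_connected:
  assumes "p \<in> upper_half" "q \<in> upper_half"
  obtains C where "connectedin (marked_moduli l) C" "p \<in> C" "q \<in> C"
proof -
  obtain x0 where x0: "p = line x0" "normalized x0" "Im \<langle>e 1, x0\<rangle> > 0"
    using assms(1) unfolding upper_half_def by blast
  obtain x1 where x1: "q = line x1" "normalized x1" "Im \<langle>e 1, x1\<rangle> > 0"
    using assms(2) unfolding upper_half_def by blast
  have im_cone: "im_vec x \<in> cone" if "normalized x" "Im \<langle>e 1, x\<rangle> > 0" for x
  proof -
    have "Re \<langle>im_vec x, im_vec x\<rangle> > 0"
      using that(1) unfolding form_im_vec_im_vec normalized_def by simp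
    moreover have "\<langle>l, im_vec x\<rangle> = 0" "\<langle>e 0, im_vec x\<rangle> = 0" "Re \<langle>e 1, im_vec x\<rangle> > 0"
      using that span_L_orth[of x] by (simp_all add: form_im_vec normalized_def)
    ultimately show ?thesis by (simp add: cone_def im_vec_real)
  qed
  define w where "w = x1 - x0"
  define y where "y t = x0 + t *s w" for t :: complex
  define x where "x t = isotropic_lift (y t)" for t
  define T where "T = {t. im_vec (y t) \<in> cone}"
  define R where "R = {\<delta> \<in> L. \<langle>\<delta>, \<delta>\<rangle> = -2}"
  define B where "B = (\<Union>\<delta>\<in>R. {t. \<langle>x t, \<delta>\<rangle> = 0})"
  have span: "x0 \<in> vec.span L" "x1 \<in> vec.span L" and e0: "\<langle>e 0, x0\<rangle> = 1" "\<langle>e 0, x1\<rangle> = 1"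
    and iso: "\<langle>x0, x0\<rangle> = 0" "\<langle>x1, x1\<rangle> = 0"
    using x0 x1 by (auto simp: normalized_def)
  have y_span: "y t \<in> vec.span L" for t
    unfolding y_def w_def using span by (intro vec.span_add vec.span_scale vec.span_diff)
  have y_e: "\<langle>e 0, y t\<rangle> = 1" for t by (simp add: y_def w_def form_linear e0)
  have y01: "y 0 = x0" "y 1 = x1" by (simp_all add: y_def w_def)
  then have x01: "x 0 = x0" "x 1 = x1" by (simp_all add: x_def isotropic_lift_def iso)
  have y_cont: "continuous_on S y" for S
    unfolding y_def by (intro continuous_intros continuous_on_scale)
  have x_cont: "continuous_on S x" for S
    unfolding x_def isotropic_lift_def
    by (intro continuous_intros continuous_on_scale continuous_on_k3_form y_cont) auto
  have T_eq: "T = {t. 0 < Re \<langle>e 1, im_vec (y t)\<rangle>} \<inter> {t. 0 < Re \<langle>im_vec (y t), im_vec (y t)\<rangle>}"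
    using span_L_orth[OF y_span] by (auto simp: T_def cone_def im_vec_real form_im_vec y_e)
  have "open T"
    unfolding T_eq
    by (intro open_Int open_Collect_less continuous_intros continuous_on_k3_form continuous_on_im_vec y_cont)
  have "convex T"
  proof (rule convexI)
    fix s t and a b :: real assume st: "s \<in> T" "t \<in> T" "0 \<le> a" "0 \<le> b" "a + b = 1"
    have "im_vec (y (a *\<^sub>R s + b *\<^sub>R t)) = of_real a *s im_vec (y s) + of_real b *s im_vec (y t)"
    proof -
      have "Im (x0 $ i) = a * Im (x0 $ i) + b * Im (x0 $ i)" for i
        using st(5) by (metis distrib_right mult_1)
      then show ?thesis
        by (simp add: y_def im_vec_def vec_eq_iff scaleR_conv_of_real algebra_simps complex_eq_iff)
    qed
    then show "a *\<^sub>R s + b *\<^sub>R t \<in> T"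
      using cone_convex[of "im_vec (y s)" "im_vec (y t)" a b] st by (simp add: T_def)
  qed
  have "R \<subseteq> k3_lattice" using L_sub by (auto simp: R_def)
  then have "countable R" by (rule countable_subset[OF _ countable_k3_lattice])
  moreover have "finite {t. \<langle>x t, \<delta>\<rangle> = 0}" if "\<delta> \<in> R" for \<delta>
  proof -
    have "\<not> (\<forall>z\<in>line x0. \<langle>z, \<delta>\<rangle> = 0)"
      using assms(1) that x0(1) by (auto simp: upper_half_def marked_periods_def R_def)
    then have "\<langle>x0, \<delta>\<rangle> \<noteq> 0" by (auto simp: line_eq form_linear)
    define c where "c = \<langle>e 0, \<delta>\<rangle> / 2"
    have "\<langle>x t, \<delta>\<rangle> = \<langle>x0, \<delta>\<rangle> + (\<langle>w, \<delta>\<rangle> - c * (2 * \<langle>x0, w\<rangle>)) * t + (- c * \<langle>w, w\<rangle>) * t\<^sup>2" for t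
      using form_sym[of w x0]
      by (simp add: x_def isotropic_lift_def y_def form_linear iso c_def power2_eq_square field_simps)
    then show ?thesis by (simp only: finite_quadratic_zeros[OF \<open>\<langle>x0, \<delta>\<rangle> \<noteq> 0\<close>])
  qed
  ultimately have "countable B"
    unfolding B_def by (intro countable_UN) (auto intro: countable_finite)
  then have "connected (T - B)"
    by (intro connected_open_diff_countable \<open>open T\<close> convex_connected[OF \<open>convex T\<close>]) simp
  have x_half: "normalized (x t)" if "t \<in> T" for t
    using that isotropic_lift_normalized[OF y_span y_e] by (simp add: x_def T_def)
  have marked: "line (x t) \<in> marked_periods L" if "t \<in> T - B" for t
  proof -
    have "x t \<in> line (x t)" unfolding line_eq by (rule range_eqI[of _ _ 1]) simp
    then show ?thesis using that normalized_period[OF x_half[of t]]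
      by (auto simp: marked_periods_def B_def R_def)
  qed
  have "continuous_map (top_of_set (T - B)) (top_of_set (vec.span L - {0})) x"
    using x_cont x_half normalized_nonzero[OF x_half] by (auto simp: normalized_def)
  from continuous_map_compose[OF this quotient_imp_continuous_map[OF quotient_map_quotient_topology, of _ line]]
  have "continuous_map (top_of_set (T - B)) (marked_moduli l) (line \<circ> x)"
    using marked by (auto simp: marked_moduli_def Let_def projective_space_def continuous_map_in_subtopology)
  then have "connectedin (marked_moduli l) ((line \<circ> x) ` (T - B))"
    by (rule connectedin_continuous_map_image) (simp add: \<open>connected (T - B)\<close>)
  moreover have "0 \<in> T - B" "1 \<in> T - B"
  proof -
    have "t \<notin> B" if "line (x t) \<in> marked_periods L" for t
    proof
      assume "t \<in> B"
      then obtain \<delta> where \<delta>: "\<delta> \<in> R" "\<langle>x t, \<delta>\<rangle> = 0" by (auto simp: B_def)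
      then have "\<forall>z\<in>line (x t). \<langle>z, \<delta>\<rangle> = 0" by (auto simp: line_eq form_linear)
      then show False using that \<delta>(1) by (auto simp: marked_periods_def R_def)
    qed
    then have "0 \<notin> B" "1 \<notin> B"
      using assms x0(1) x1(1) x01 by (auto simp: upper_half_def)
    then show "0 \<in> T - B" "1 \<in> T - B"
      using im_cone x0 x1 by (simp_all add: T_def y01)
  qed
  then have "p \<in> (line \<circ> x) ` (T - B)" "q \<in> (line \<circ> x) ` (T - B)"
    using x01 x0(1) x1(1) by (auto simp: image_iff)
  ultimately show thesis by (rule that)
qed

section \<open>Counting components\<close>

lemma torsion_moduli_component:
  assumes r: "r > 0" and v: "v \<in> order_elements l r" and "p \<in> upper_half" "q \<in> upper_half"
  shows "connected_component_of (torsion_moduli l r) (stable_orbit l (p, v)) (stable_orbit l (q, v))"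
proof -
  obtain C where C: "connectedin (marked_moduli l) C" "p \<in> C" "q \<in> C"
    using upper_half_connected assms(3,4) by blast
  have "connectedin (prod_topology (marked_moduli l) (discrete_topology (order_elements l r))) (C \<times> {v})"
    using C(1) v by (simp add: connectedin_Times)
  then have "connectedin (torsion_moduli l r) (stable_orbit l ` (C \<times> {v}))"
    unfolding torsion_moduli_def
    by (rule connectedin_continuous_map_image[OF quotient_imp_continuous_map[OF quotient_map_quotient_topology]])
  then show ?thesis using C(2,3) unfolding connected_component_of_def by blast
qed

text \<open>
  The orbit is unchanged by \<open>G\<close>. After \<open>v\<close> has been moved to a normal form, \<open>flip\<close> is still free to
  move the period into the upper half, because it fixes that normal form.
\<close>

lemma torsion_moduli_normal_form:
  assumes r: "r > 0" and z: "z \<in> topspace (torsion_moduli l r)"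
  obtains p n k where "p \<in> upper_half" "0 \<le> n" "n < int r" "0 \<le> k" "k < int (gcd r (2 * m))"
    "torsion_class r (normal_vector n k) \<in> order_elements l r"
    "z = stable_orbit l (p, torsion_class r (normal_vector n k))"
proof -
  obtain p v where p: "p \<in> marked_periods L" and v: "v \<in> order_elements l r" and z_eq: "z = stable_orbit l (p, v)"
    using z by (auto simp: torsion_moduli_def topspace_marked_moduli)
  obtain g n k where g: "g \<in> G" and nk: "0 \<le> n" "n < int r" "0 \<le> k" "k < int (gcd r (2 * m))"
    and gv: "g ` v = torsion_class r (normal_vector n k)"
    using normal_form[OF r v] by metis
  let ?v = "torsion_class r (normal_vector n k)"
  have z_g: "z = stable_orbit l (g ` p, ?v)" using stable_orbit_G[OF g, of p v] gv z_eq by simp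
  have v': "?v \<in> order_elements l r" using G_order_elements[OF g v r] gv by simp
  have "flip ` ?v = ?v" by (simp add: G_torsion_class[OF flip_G] flip_normal_vector)
  then have z_flip: "z = stable_orbit l (flip ` g ` p, ?v)"
    using stable_orbit_G[OF flip_G, of "g ` p" ?v] z_g by simp
  from upper_half_or_flip[OF G_marked[OF g p]] show thesis
    using that[OF _ nk v'] z_g z_flip by blast
qed

lemma card_components:
  assumes r: "r > 0"
  shows "finite (connected_components_of (torsion_moduli l r)) \<and>
    card (connected_components_of (torsion_moduli l r)) \<le> r * gcd r (2 * m)"
proof -
  let ?X = "torsion_moduli l r"
  define I where "I = {0..<int r} \<times> {0..<int (gcd r (2 * m))}"
  define p0 where "p0 = (SOME p. p \<in> upper_half)"
  define F where "F = (\<lambda>(n, k). connected_component_of_set ?X (stable_orbit l (p0, torsion_class r (normal_vector n k))))"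
  have "connected_components_of ?X \<subseteq> F ` I"
  proof
    fix c assume "c \<in> connected_components_of ?X"
    then obtain z where z: "z \<in> topspace ?X" "c = connected_component_of_set ?X z"
      by (auto simp: connected_components_of_def)
    obtain p n k where p: "p \<in> upper_half" and nk: "0 \<le> n" "n < int r" "0 \<le> k" "k < int (gcd r (2 * m))"
      and v: "torsion_class r (normal_vector n k) \<in> order_elements l r"
      and z_eq: "z = stable_orbit l (p, torsion_class r (normal_vector n k))"
      using torsion_moduli_normal_form[OF r z(1)] by metis
    have "p0 \<in> upper_half" unfolding p0_def using p by (rule someI)
    from torsion_moduli_component[OF r v p this] have "c = F (n, k)"
      unfolding F_def z(2) z_eq by (simp add: connected_component_of_equiv)
    then show "c \<in> F ` I" using nk by (auto simp: I_def)
  qed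
  then have sub: "connected_components_of ?X \<subseteq> F ` I" .
  have fin: "finite I" by (simp add: I_def)
  then have "card (connected_components_of ?X) \<le> card (F ` I)" by (intro card_mono sub finite_imageI)
  also have "\<dots> \<le> card I" using fin by (rule card_image_le)
  also have "card I = r * gcd r (2 * m)" by (simp add: I_def)
  finally show ?thesis using finite_subset[OF sub] fin by simp
qed

end

theorem proposition2p5:
  fixes d r :: nat and l :: k3_space
  assumes "even d" and "d \<ge> 2" and "r \<ge> 1"
    and "primitive_in k3_lattice l" and "k3_form l l = of_nat d"
  shows "finite (connected_components_of (torsion_moduli l r))
       \<and> card (connected_components_of (torsion_moduli l r)) \<le> r * gcd r d"
proof -
  obtain e f where "polarized_frame e f l (d div 2)"
    using exists_polarized_frame[OF assms(1,2,4,5)] by blast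
  then interpret polarized_frame e f l "d div 2" .
  show ?thesis using card_components[of r] assms(1,3) by simp
qed

end
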